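(* Let $(G,\alpha)$ be a totally disconnected, locally compact contraction group such that $G$ is a torsion group and abelian. Then $(G,\alpha)$ is isomorphic, as a contraction group, to $F^{(-\mathbb{N})}\times F^{\mathbb{N}_0}$ with the right shift for some finite abelian group $F$, which is determined up to isomorphism. Conversely, every such contraction group (i.e. $F^{(-\mathbb{N})}\times F^{\mathbb{N}_0}$ with the right shift, for $F$ a finite abelian group) is an abelian torsion group.
   Context: A locally compact contraction group is a pair $(G,\alpha)$ where $G$ is a (Hausdorff) locally compact group and $\alpha\colon G\to G$ is a bicontinuous automorphism with $\alpha^n(x)\to e$ as $n\to\infty$ for each $x\in G$. An isomorphism $(G,\alpha_G)\to(H,\alpha_H)$ of contraction groups is an isomorphism of topological groups $\phi\colon G\to H$ with $\alpha_H\circ\phi=\phi\circ\alpha_G$. $\mathbb{N}=\{1,2,\ldots\}$, $\mathbb{N}_0=\mathbb{N}\cup\{0\}$. For a finite group $F$, $F^{\mathbb{N}_0}$ carries the compact product topology, $F^{(-\mathbb{N})}$ is the group of sequences $(x_n)_{n\in-\mathbb{N}}$ in $F$ with $x_n=e$ for all but finitely many $n$, with the discrete topology, and $F^{(-\mathbb{N})}\times F^{\mathbb{N}_0}$ carries the product topology. Its elements are viewed as two-sided sequences $(x_n)_{n\in\mathbb{Z}}$, and the right shift is $(x_n)_{n\in\mathbb{Z}}\mapsto(x_{n-1})_{n\in\mathbb{Z}}$. *)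

theory Defs
  imports "HOL-Analysis.Analysis" "HOL-Algebra.Product_Groups"
begin

definition totally_disconnected_space :: "'a topology \<Rightarrow> bool" where
  "totally_disconnected_space X \<longleftrightarrow> (\<forall>S. connectedin X S \<longrightarrow> (\<exists>a. S \<subseteq> {a}))"

definition torsion_group :: "('a, 'm) monoid_scheme \<Rightarrow> bool" where
  "torsion_group G \<longleftrightarrow> group G \<and> (\<forall>x\<in>carrier G. \<exists>n::nat. n > 0 \<and> x [^]\<^bsub>G\<^esub> n = \<one>\<^bsub>G\<^esub>)"

locale topological_group = group G for G (structure) +
  fixes T :: "'a topology"
  assumes topspace_eq: "topspace T = carrier G"
    and continuous_mult: "continuous_map (prod_topology T T) T (\<lambda>(x, y). x \<otimes> y)"
    and continuous_inv: "continuous_map T T (\<lambda>x. inv x)"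

text \<open>Only the values of \<open>\<alpha>\<close> on the carrier matter.\<close>

locale lc_contraction_group = topological_group G T for G (structure) and T +
  fixes \<alpha> :: "'a \<Rightarrow> 'a"
  assumes Hausdorff: "Hausdorff_space T"
    and locally_compact: "locally_compact_space T"
    and automorphism: "\<alpha> \<in> iso G G"
    and bicontinuous: "homeomorphic_map T T \<alpha>"
    and contractive: "x \<in> carrier G \<Longrightarrow> limitin T (\<lambda>n. (\<alpha> ^^ n) x) \<one> sequentially"

definition isomorphic_contraction_groups ::
  "('a, 'm) monoid_scheme \<Rightarrow> 'a topology \<Rightarrow> ('a \<Rightarrow> 'a) \<Rightarrow>
   ('b, 'n) monoid_scheme \<Rightarrow> 'b topology \<Rightarrow> ('b \<Rightarrow> 'b) \<Rightarrow> bool" where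
  "isomorphic_contraction_groups G T \<alpha> H S \<beta> \<longleftrightarrow>
     (\<exists>\<phi>. \<phi> \<in> iso G H \<and> homeomorphic_map T S \<phi> \<and> (\<forall>x\<in>carrier G. \<beta> (\<phi> x) = \<phi> (\<alpha> x)))"

text \<open>
  The group \<open>F\<^sup>(\<^sup>-\<^sup>\<nat>\<^sup>) \<times> F\<^sup>\<nat>\<^sup>0\<close>: both factors consist of extensional functions, on the
  negative and on the nonnegative integers respectively, so that a pair is a two-sided
  sequence cut at \<open>0\<close>. The constant \<open>sum_group\<close> is the finitely supported (restricted) product.
\<close>

definition shift_group :: "('a, 'm) monoid_scheme \<Rightarrow> ((int \<Rightarrow> 'a) \<times> (int \<Rightarrow> 'a)) monoid" where
  "shift_group F = sum_group {..<0} (\<lambda>_. F) \<times>\<times> product_group {0..} (\<lambda>_. F)"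

definition shift_topology :: "('a, 'm) monoid_scheme \<Rightarrow> ((int \<Rightarrow> 'a) \<times> (int \<Rightarrow> 'a)) topology" where
  "shift_topology F =
     prod_topology (discrete_topology (carrier (sum_group {..<0} (\<lambda>_. F))))
                   (product_topology (\<lambda>_. discrete_topology (carrier F)) {0..})"

definition two_sided :: "(int \<Rightarrow> 'a) \<times> (int \<Rightarrow> 'a) \<Rightarrow> int \<Rightarrow> 'a" where
  "two_sided p n = (if n < 0 then fst p n else snd p n)"

definition right_shift :: "(int \<Rightarrow> 'a) \<times> (int \<Rightarrow> 'a) \<Rightarrow> (int \<Rightarrow> 'a) \<times> (int \<Rightarrow> 'a)" where
  "right_shift p = (\<lambda>n\<in>{..<0}. two_sided p (n - 1), \<lambda>n\<in>{0..}. two_sided p (n - 1))"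

end

theory Submission
  imports Defs "HOL-Number_Theory.Cong" "HOL-Algebra.Multiplicative_Group"
    "HOL-Computational_Algebra.Formal_Laurent_Series" "HOL-Library.Function_Algebras"
begin

text \<open>
  Existence. Van Dantzig's theorem and Baire's theorem give a compact open subgroup \<open>U\<close> with
  \<open>\<alpha> U \<subseteq> U\<close> whose iterates \<open>\<alpha>\<^sup>k U\<close> form a neighbourhood base, and a finite exponent \<open>e\<close>
  of \<open>G\<close>. With a finite set \<open>R\<close> of residues of \<open>U\<close> modulo \<open>\<alpha> U\<close>, every element of \<open>G\<close> is a
  convergent series in the \<open>\<alpha>\<^sup>k r\<close>, so \<open>G\<close> is a quotient of the free module over
  \<open>\<int>((X))\<close> on \<open>R\<close>, with \<open>X\<close> acting as \<open>\<alpha>\<close>. Modulo a prime \<open>p\<close> this ring is a field, which suffices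
  to run the structure theory of finite abelian groups: a generating set of prime power order elements
  with minimal sum of orders has only trivial relations. Hence \<open>G\<close> is a direct sum of
  modules \<open>(\<int>/q)((X))\<close>, and \<open>F\<close> is the direct sum of the \<open>\<int>/q\<close>.

  Uniqueness. An isomorphism of shifts embeds \<open>F\<^sub>1\<^sup>n\<close> into \<open>F\<^sub>2\<^sup>n\<^sup>+\<^sup>2\<^sup>c\<close> with \<open>c\<close> independent
  of \<open>n\<close>. Counting homomorphisms from a finite group \<open>H\<close> and letting \<open>n\<close> grow shows that
  \<open>F\<^sub>1\<close> and \<open>F\<^sub>2\<close> receive equally many homomorphisms from \<open>H\<close>, whence they are isomorphic by
  Lovasz's argument.
\<close>

text \<open>The natural scalars would be (Z/e)((X)), but e is found inside the proof and cannot
  index a type. Hence the scalars stay integral, quotients are replaced by congruence modulo a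
  submodule N containing e V, and of the scalars one fact is carried along: modulo a prime, each of
  them is zero or invertible. The isomorphism must also be a homeomorphism. Therefore every
  statement about series keeps track of where the series starts: passing between \<alpha>^k U and
  the sequences trivial below k costs an index shift that does not depend on k, and this is
  continuity at the identity in both directions. The constant c of the uniqueness half has the same
  origin: continuity provides it for one level, equivariance carries it to all others. The maps from
  H are counted subject to killing a set N, since the inclusion-exclusion compares counts for all
  quotients of H.\<close>

section \<open>Torsion quotients of modules\<close>

notation fls_nth (infixl \<open>$$\<close> 75)

text \<open>\<open>N\<close> stands for the zero of a quotient that is never formed as a type.
  \<open>unit_mod_prime\<close> says that every class of \<open>'k\<close> modulo a prime is zero or
  a unit, which lets the scalars imitate the integers in the theory of finite abelian
  groups.\<close>

locale torsion_quotient = Modules.module scale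
  for scale :: "'k::comm_ring_1 \<Rightarrow> 'v::ab_group_add \<Rightarrow> 'v" (infixr \<open>\<star>\<close> 75) +
  fixes N :: "'v set" and e :: nat
  assumes subspace_N: "subspace N"
    and exponent_pos: "0 < e"
    and exponent_kills: "of_nat e \<star> v \<in> N"
    and unit_mod_prime: "prime (p::nat) \<Longrightarrow> of_nat p dvd (d::'k) \<or> (\<exists>d'. of_nat p dvd d * d' - 1)"
begin

definition quot_ord :: "'v \<Rightarrow> nat" where
  "quot_ord x = (LEAST n. 0 < n \<and> of_nat n \<star> x \<in> N)"

lemma quot_ord_pos: "0 < quot_ord x"
  and quot_ord_scale: "of_nat (quot_ord x) \<star> x \<in> N"
proof -
  have "0 < quot_ord x \<and> of_nat (quot_ord x) \<star> x \<in> N"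
    unfolding quot_ord_def by (rule LeastI[of _ e]) (simp add: exponent_pos exponent_kills)
  then show "0 < quot_ord x" "of_nat (quot_ord x) \<star> x \<in> N" by auto
qed

lemma scale_mem_if_dvd:
  assumes "of_nat (quot_ord x) dvd c"
  shows "c \<star> x \<in> N"
proof -
  obtain d where "c = of_nat (quot_ord x) * d" using assms by blast
  then have "c \<star> x = d \<star> (of_nat (quot_ord x) \<star> x)" by (simp add: mult.commute)
  then show ?thesis using subspace_scale[OF subspace_N quot_ord_scale] by simp
qed

lemma quot_ord_dvd_iff: "of_nat n \<star> x \<in> N \<longleftrightarrow> quot_ord x dvd n"
proof
  assume "of_nat n \<star> x \<in> N"
  have "of_nat n = of_nat (n div quot_ord x) * of_nat (quot_ord x) + (of_nat (n mod quot_ord x) :: 'k)"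
    by (metis div_mult_mod_eq of_nat_add of_nat_mult)
  then have "of_nat (n mod quot_ord x) \<star> x
      = of_nat n \<star> x - of_nat (n div quot_ord x) \<star> (of_nat (quot_ord x) \<star> x)"
    by (simp add: scale_left_distrib)
  also have "\<dots> \<in> N"
    by (rule subspace_diff[OF subspace_N \<open>of_nat n \<star> x \<in> N\<close> subspace_scale[OF subspace_N quot_ord_scale]])
  finally have "of_nat (n mod quot_ord x) \<star> x \<in> N" .
  moreover have "n mod quot_ord x < quot_ord x" using quot_ord_pos by simp
  ultimately have "n mod quot_ord x = 0"
    using not_less_Least[of "n mod quot_ord x" "\<lambda>n. 0 < n \<and> of_nat n \<star> x \<in> N"]
    unfolding quot_ord_def[symmetric] by auto
  then show "quot_ord x dvd n" by auto
next
  assume "quot_ord x dvd n"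
  then show "of_nat n \<star> x \<in> N" by (intro scale_mem_if_dvd) (auto elim!: dvdE)
qed

lemma quot_ord_dvd_exponent: "quot_ord x dvd e"
  using exponent_kills quot_ord_dvd_iff by blast

text \<open>Integer Bezout coefficients map into any commutative ring, so coprime integers stay
  comaximal in \<open>'k\<close> without a theory of divisors there.\<close>

lemma of_nat_coprime_Bezout:
  assumes "coprime m (n::nat)"
  obtains u v :: 'k where "u * of_nat m + v * of_nat n = 1"
proof -
  obtain u v where "u * int m + v * int n = 1"
    using assms by (metis bezout_int coprime_int_iff coprime_imp_gcd_eq_1)
  then have "of_int (u * int m + v * int n) = (1::'k)" by (metis of_int_1)
  then show ?thesis using that[of "of_int u" "of_int v"] by simp
qed

lemma coprime_of_nat_dvd_cancel:
  assumes "coprime m (n::nat)" "of_nat m dvd of_nat n * (c::'k)"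
  shows "of_nat m dvd c"
proof -
  obtain u v :: 'k where uv: "u * of_nat m + v * of_nat n = 1"
    using of_nat_coprime_Bezout[OF assms(1)] .
  have "c = of_nat m * (u * c) + v * (of_nat n * c)"
    using arg_cong[OF uv, of "\<lambda>t. t * c"] by (simp add: algebra_simps)
  then show ?thesis using assms(2) by (metis dvd_add dvd_mult dvd_triv_left)
qed

text \<open>The exponent 0 is included, so members of \<open>N\<close> are primary. An exchange of
  generators may produce such an element, which then needs no separate treatment.\<close>

definition primary :: "'v set" where
  "primary = {x. \<exists>p a. prime p \<and> quot_ord x = p ^ a}"

lemma primary_if_prime_power_scale:
  assumes "prime p" "of_nat (p ^ a) \<star> x \<in> N"
  shows "x \<in> primary"
proof -
  have "quot_ord x dvd p ^ a" using assms(2) quot_ord_dvd_iff by blast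
  then obtain i where "quot_ord x = p ^ i"
    using assms(1) divides_primepow_nat by blast
  then show ?thesis using assms(1) unfolding primary_def by auto
qed

text \<open>Peel off one prime at a time. If n = p^a m kills the class of x and p does not divide m,
  Bezout writes x as a combination of p^a x, killed by m < n, and of m x, killed by p^a and hence
  primary.\<close>

lemma span_primary: "span primary = UNIV"
proof -
  have "x \<in> span primary" if "0 < n" "of_nat n \<star> x \<in> N" for n x
    using that
  proof (induction n arbitrary: x rule: less_induct)
    case (less n)
    show ?case
    proof (cases "n = 1")
      case True
      then have "of_nat (2 ^ 0) \<star> x \<in> N" using less.prems by simp
      then show ?thesis using primary_if_prime_power_scale[OF two_is_prime_nat] span_base by blast
    next
      case False
      then obtain p where p: "prime p" "p dvd n" using prime_factor_nat by blast
      obtain a m where n: "n = p ^ a * m" "\<not> p dvd m"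
        using less.prems(1) p multiplicity_decompose'[of n p] by (metis not_prime_unit not_less0)
      have "a \<noteq> 0" using n p by (intro notI) auto
      have "1 < p ^ a" using p \<open>a \<noteq> 0\<close> by (metis one_less_power prime_gt_1_nat neq0_conv)
      then have "m < n" "0 < m" using n less.prems(1) by auto
      have "coprime (p ^ a) m" using n(2) p(1) by (simp add: prime_imp_coprime)
      then obtain u v :: 'k where uv: "u * of_nat (p ^ a) + v * of_nat m = 1"
        using of_nat_coprime_Bezout by blast
      have "of_nat m \<star> (of_nat (p ^ a) \<star> x) \<in> N" "of_nat (p ^ a) \<star> (of_nat m \<star> x) \<in> N"
        using less.prems(2) n(1) by (simp_all add: mult.commute)
      then have *: "of_nat (p ^ a) \<star> x \<in> span primary" "of_nat m \<star> x \<in> span primary"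
        using less.IH[OF \<open>m < n\<close> \<open>0 < m\<close>] primary_if_prime_power_scale[OF p(1)] span_base by blast+
      have "u \<star> (of_nat (p ^ a) \<star> x) + v \<star> (of_nat m \<star> x) \<in> span primary"
        by (rule span_add[OF span_scale[OF *(1)] span_scale[OF *(2)]])
      also have "u \<star> (of_nat (p ^ a) \<star> x) + v \<star> (of_nat m \<star> x) = x"
        using uv by (simp add: scale_left_distrib[symmetric])
      finally show ?thesis .
    qed
  qed
  then show ?thesis using exponent_pos exponent_kills by blast
qed

text \<open>If d d' = 1 - p w, multiplying by a finite geometric series in p w turns the inverse
  modulo p into one modulo p^a.\<close>

lemma unit_mod_prime_power:
  assumes "prime (p::nat)" "\<not> of_nat p dvd (d::'k)"
  obtains d' where "of_nat (p ^ a) dvd d * d' - 1"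
proof -
  obtain d' where "of_nat p dvd d * d' - 1" using unit_mod_prime assms by blast
  then obtain w where w: "d * d' = 1 - of_nat p * w" 
    by (metis dvdE add.commute diff_add_cancel minus_diff_eq minus_mult_right diff_conv_add_uminus)
  have "1 - (of_nat p * w) ^ a = (1 - of_nat p * w) * (\<Sum>i<a. (of_nat p * w) ^ i)"
    by (rule one_diff_power_eq)
  then have "d * (d' * (\<Sum>i<a. (of_nat p * w) ^ i)) - 1 = of_nat (p ^ a) * (- (w ^ a))"
    using w by (simp add: power_mult_distrib mult.assoc[symmetric]) (metis add_diff_cancel_left' diff_add_cancel minus_diff_eq)
  then show ?thesis using that by (metis dvd_triv_left)
qed

text \<open>Steinitz exchange modulo \<open>N\<close>: the coefficient of \<open>x0\<close> in
  \<open>y\<close> is invertible modulo the order of \<open>x0\<close>, so \<open>x0\<close> is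
  recovered from \<open>y\<close> and the other generators up to an element of
  \<open>N\<close>.\<close>

lemma span_insert_N_exchange:
  assumes "finite Y" "Y \<subseteq> X" "x0 \<in> Y" "y = (\<Sum>x\<in>Y. d x \<star> x)"
    and "of_nat (quot_ord x0) dvd d x0 * d' - 1"
    and "span (X \<union> N) = UNIV"
  shows "span (insert y (X - {x0}) \<union> N) = UNIV"
proof -
  let ?Z = "span (insert y (X - {x0}) \<union> N)"
  have N: "z \<in> ?Z" if "z \<in> N" for z using that by (simp add: span_base)
  have "y = d x0 \<star> x0 + (\<Sum>x\<in>Y - {x0}. d x \<star> x)"
    using assms by (simp add: sum.remove)
  moreover have "(\<Sum>x\<in>Y - {x0}. d x \<star> x) \<in> ?Z"
    using assms(2) by (intro span_sum span_scale span_base) auto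
  moreover have "y \<in> ?Z" by (simp add: span_base)
  ultimately have "d x0 \<star> x0 \<in> ?Z" by (metis span_add_eq2)
  then have "d' \<star> (d x0 \<star> x0) \<in> ?Z" by (rule span_scale)
  moreover have "d' \<star> (d x0 \<star> x0) - (d x0 * d' - 1) \<star> x0 = x0"
    by (simp add: scale_left_diff_distrib mult.commute)
  ultimately have "x0 \<in> ?Z" using N[OF scale_mem_if_dvd[OF assms(5)]] by (metis span_diff)
  then have "X \<union> N \<subseteq> ?Z" by (auto intro: span_base)
  then show ?thesis using assms(6) span_minimal[of "X \<union> N" ?Z] by auto
qed

text \<open>
  A nontrivial relation between generators of prime power order can be divided by the highest
  possible power of a prime \<open>p\<close>; some coefficient is then invertible modulo \<open>p\<close>, and the
  corresponding generator may be exchanged for one of smaller order.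
\<close>

lemma relation_decreases_order:
  assumes X: "finite X" "X \<subseteq> primary" "span (X \<union> N) = UNIV"
    and rel: "(\<Sum>x\<in>X. c x \<star> x) \<in> N" and x1: "x1 \<in> X" "\<not> of_nat (quot_ord x1) dvd c x1"
  obtains X' where "finite X'" "X' \<subseteq> primary" "span (X' \<union> N) = UNIV"
    "(\<Sum>x\<in>X'. quot_ord x) < (\<Sum>x\<in>X. quot_ord x)"
proof -
  obtain p b where p: "prime p" "quot_ord x1 = p ^ b"
    using x1 X(2) unfolding primary_def by blast
  obtain k m where e: "e = p ^ k * m" "\<not> p dvd m"
    using exponent_pos p multiplicity_decompose'[of e p] by (metis not_prime_unit not_less0)
  have cop: "coprime (p ^ i) m" for i using e(2) p(1) by (simp add: prime_imp_coprime)
  \<comment> \<open>Multiplying by the prime-to-p part m of e makes the coefficients at generators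
    belonging to other primes divisible by their orders. Since m is coprime to p, the nontrivial
    term at \<open>x1\<close> survives.\<close>
  define c' where "c' x = of_nat m * c x" for x
  define Y where "Y = {x\<in>X. \<not> of_nat (quot_ord x) dvd c' x}"
  have finY: "finite Y" and YX: "Y \<subseteq> X" using X(1) unfolding Y_def by auto
  have x1Y: "x1 \<in> Y"
    using x1 p(2) coprime_of_nat_dvd_cancel[OF cop[of b], of "c x1"] unfolding Y_def c'_def by auto
  have Yp: "\<exists>a. quot_ord x = p ^ a" if xY: "x \<in> Y" for x
  proof -
    obtain q a where q: "prime q" "quot_ord x = q ^ a"
      using xY YX X(2) unfolding primary_def by blast
    show ?thesis
    proof (cases "q = p")
      case False
      then have "coprime (q ^ a) (p ^ k)"
        using q(1) p(1) by (simp add: primes_coprime)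
      then have "quot_ord x dvd m"
        using quot_ord_dvd_exponent[of x] q(2) e(1) by (simp add: coprime_dvd_mult_right_iff)
      then have "of_nat (quot_ord x) dvd c' x" unfolding c'_def by (auto elim!: dvdE)
      then show ?thesis using xY unfolding Y_def by blast
    qed (use q in blast)
  qed
  have "(\<Sum>x\<in>X. c' x \<star> x) = of_nat m \<star> (\<Sum>x\<in>X. c x \<star> x)"
    by (simp add: c'_def scale_sum_right)
  then have "(\<Sum>x\<in>X. c' x \<star> x) \<in> N" using subspace_scale[OF subspace_N rel] by simp
  moreover have "(\<Sum>x\<in>X - Y. c' x \<star> x) \<in> N"
    by (intro subspace_sum subspace_N scale_mem_if_dvd) (auto simp: Y_def)
  moreover have "(\<Sum>x\<in>Y. c' x \<star> x) = (\<Sum>x\<in>X. c' x \<star> x) - (\<Sum>x\<in>X - Y. c' x \<star> x)"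
    using sum.subset_diff[OF YX X(1), of "\<lambda>x. c' x \<star> x"] by simp
  ultimately have relY: "(\<Sum>x\<in>Y. c' x \<star> x) \<in> N" by (metis subspace_diff subspace_N)
  \<comment> \<open>At each x in \<open>Y\<close> the order p^a does not divide the coefficient, so
    a common factor p^v has v < a. This bounds v and later makes the new generator smaller.\<close>
  define P where "P v \<longleftrightarrow> (\<forall>x\<in>Y. of_nat (p ^ v) dvd c' x)" for v
  have Pb: "v < a" if "P v" "x \<in> Y" "quot_ord x = p ^ a" for v a x
  proof (rule ccontr)
    assume "\<not> v < a"
    then have "(of_nat (p ^ a) :: 'k) dvd of_nat (p ^ v)" by (simp add: le_imp_power_dvd)
    then show False using that dvd_trans unfolding P_def Y_def by (metis (lifting) mem_Collect_eq)
  qed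
  define v where "v = (GREATEST v. P v)"
  have bound: "\<And>v. P v \<Longrightarrow> v \<le> b" using Pb x1Y p(2) by (meson less_imp_le)
  have Pv: "P v" unfolding v_def by (rule GreatestI_nat[of P 0, OF _ bound]) (auto simp: P_def)
  have nPv: "\<not> P (Suc v)" unfolding v_def using Greatest_le_nat[of P _ b, OF _ bound] by fastforce
  from Pv have "\<forall>x\<in>Y. \<exists>d. c' x = of_nat (p ^ v) * d" unfolding P_def by (auto elim!: dvdE)
  then obtain d where d: "\<And>x. x \<in> Y \<Longrightarrow> c' x = of_nat (p ^ v) * d x" by metis
  from nPv obtain x0 where x0: "x0 \<in> Y" "\<not> of_nat p dvd d x0"
    unfolding P_def using d mult_dvd_mono[OF dvd_refl[of "of_nat (p ^ v)"], of "of_nat p" "d _"]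
    by (auto simp: mult.commute)
  obtain a where a: "quot_ord x0 = p ^ a" using Yp x0 by blast
  obtain d' where d': "of_nat (p ^ a) dvd d x0 * d' - 1"
    using unit_mod_prime_power[OF p(1) x0(2)] by blast
  define y where "y = (\<Sum>x\<in>Y. d x \<star> x)"
  have "of_nat (p ^ v) \<star> y = (\<Sum>x\<in>Y. c' x \<star> x)"
    unfolding y_def scale_sum_right by (intro sum.cong) (simp_all add: d)
  then have py: "of_nat (p ^ v) \<star> y \<in> N" using relY by metis
  \<comment> \<open>p^v y is the relation itself, so the order of y divides p^v, which is below the
    order p^a of \<open>x0\<close>.\<close>
  have "quot_ord y \<le> p ^ v"
    using py[unfolded quot_ord_dvd_iff] p(1) by (intro dvd_imp_le) (auto simp: prime_gt_0_nat)
  also have "\<dots> < quot_ord x0"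
    unfolding a by (rule power_strict_increasing[OF Pb[OF Pv x0(1) a] prime_gt_1_nat[OF p(1)]])
  finally have less: "quot_ord y < quot_ord x0" .
  show thesis
  proof (rule that)
    show "finite (insert y (X - {x0}))" using X(1) by simp
    show "insert y (X - {x0}) \<subseteq> primary"
      using X(2) primary_if_prime_power_scale[OF p(1) py] by auto
    show "span (insert y (X - {x0}) \<union> N) = UNIV"
      using span_insert_N_exchange[OF finY YX x0(1) y_def _ X(3)] d' a by auto
    \<comment> \<open>Only an inequality, because y may already belong to
      \<open>X - {x0}\<close>.\<close>
    have "(\<Sum>x\<in>insert y (X - {x0}). quot_ord x) \<le> quot_ord y + (\<Sum>x\<in>X - {x0}. quot_ord x)"
      using X(1) by (simp add: sum.insert_if)
    also have "\<dots> < quot_ord x0 + (\<Sum>x\<in>X - {x0}. quot_ord x)" using less by simp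
    also have "\<dots> = (\<Sum>x\<in>X. quot_ord x)" using X(1) x0(1) YX by (subst sum.remove[of X x0]) auto
    finally show "(\<Sum>x\<in>insert y (X - {x0}). quot_ord x) < (\<Sum>x\<in>X. quot_ord x)" .
  qed
qed

theorem cyclic_decomposition:
  assumes "finite S" "span (S \<union> N) = UNIV"
  obtains X where "finite X" "span (X \<union> N) = UNIV"
    "\<And>c. (\<Sum>x\<in>X. c x \<star> x) \<in> N \<longleftrightarrow> (\<forall>x\<in>X. of_nat (quot_ord x) dvd c x)"
proof -
  define good where "good X \<longleftrightarrow> finite X \<and> X \<subseteq> primary \<and> span (X \<union> N) = UNIV" for X
  \<comment> \<open>The given generators need not have prime power order; each is replaced by
    finitely many primary elements whose span contains it.\<close>
  have "\<exists>Y. finite Y \<and> Y \<subseteq> primary \<and> s \<in> span Y" for s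
  proof -
    have "s \<in> span primary" using span_primary by simp
    then show ?thesis unfolding span_explicit by auto
  qed
  then obtain Y where Y: "\<And>s. finite (Y s)" "\<And>s. Y s \<subseteq> primary" "\<And>s. s \<in> span (Y s)" by metis
  have "S \<union> N \<subseteq> span ((\<Union>s\<in>S. Y s) \<union> N)"
    using Y(3) span_mono[of "Y _" "(\<Union>s\<in>S. Y s) \<union> N"] by (force intro: span_base)
  then have "span ((\<Union>s\<in>S. Y s) \<union> N) = UNIV"
    using assms(2) span_minimal[of "S \<union> N" "span ((\<Union>s\<in>S. Y s) \<union> N)"] by auto
  then have "good (\<Union>s\<in>S. Y s)" using Y assms(1) unfolding good_def by auto
  then obtain X where X: "good X" "\<And>X'. good X' \<Longrightarrow> (\<Sum>x\<in>X. quot_ord x) \<le> (\<Sum>x\<in>X'. quot_ord x)"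
    using ex_has_least_nat[of good _ "\<lambda>X. \<Sum>x\<in>X. quot_ord x"] by blast
  show thesis
  proof (rule that)
    show "finite X" "span (X \<union> N) = UNIV" using X(1) unfolding good_def by auto
    fix c
    show "(\<Sum>x\<in>X. c x \<star> x) \<in> N \<longleftrightarrow> (\<forall>x\<in>X. of_nat (quot_ord x) dvd c x)"
    proof
      assume "(\<Sum>x\<in>X. c x \<star> x) \<in> N"
      then show "\<forall>x\<in>X. of_nat (quot_ord x) dvd c x"
        using X relation_decreases_order[of X c] unfolding good_def by (metis not_less)
    next
      assume "\<forall>x\<in>X. of_nat (quot_ord x) dvd c x"
      then show "(\<Sum>x\<in>X. c x \<star> x) \<in> N"
        by (intro subspace_sum subspace_N scale_mem_if_dvd) auto
    qed
  qed
qed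

end

section \<open>Laurent series with integer coefficients\<close>

lemma of_nat_dvd_int_fls_iff:
  fixes f :: "int fls"
  shows "of_nat n dvd f \<longleftrightarrow> (\<forall>k. int n dvd f $$ k)"
proof
  assume "\<forall>k. int n dvd f $$ k"
  obtain m where "\<And>k. k < m \<Longrightarrow> f $$ k = 0" using fls_nth_vanishes_belowE by blast
  then have "(Abs_fls (\<lambda>k. f $$ k div int n)) $$ k = f $$ k div int n" for k
    by (intro nth_Abs_fls_lower_bound[of m]) auto
  then have "f = of_nat n * Abs_fls (\<lambda>k. f $$ k div int n)"
    using \<open>\<forall>k. int n dvd f $$ k\<close> by (intro fls_eqI) auto
  then show "of_nat n dvd f" by (metis dvd_triv_left)
qed (auto elim!: dvdE)

text \<open>Modulo p, the series d starts at the first coefficient that p does not divide, at index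
  l. Dividing by X^l and by that coefficient modulo p leaves a power series with constant term 1,
  which is invertible already over the integers.\<close>

lemma int_fls_unit_mod_prime:
  fixes d :: "int fls"
  assumes "prime p" "\<not> of_nat p dvd d"
  obtains d' where "of_nat p dvd d * d' - 1"
proof -
  obtain m where m: "\<And>k. k < m \<Longrightarrow> d $$ k = 0" using fls_nth_vanishes_belowE by blast
  define P where "P i \<longleftrightarrow> \<not> int p dvd d $$ (m + int i)" for i
  obtain k where k: "\<not> int p dvd d $$ k" using assms(2) of_nat_dvd_int_fls_iff by blast
  then have "m \<le> k" using m by (metis dvd_0_right not_le)
  with k have "P (nat (k - m))" by (simp add: P_def)
  define l where "l = m + int (LEAST i. P i)"
  have l: "\<not> int p dvd d $$ l"
    using LeastI[of P, OF \<open>P (nat (k - m))\<close>] unfolding l_def P_def .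
  have below: "int p dvd d $$ i" if "i < l" for i
  proof (cases "i < m")
    case False
    then show ?thesis using not_less_Least[of "nat (i - m)" P] that unfolding l_def P_def by auto
  qed (simp add: m)
  have "coprime (d $$ l) (int p)"
    using l assms(1) by (simp add: coprime_commute prime_imp_coprime)
  then obtain u where u: "[d $$ l * u = 1] (mod int p)" using cong_solve_coprime_int by blast
  \<comment> \<open>The constant term is set to 1 instead of \<open>u * d $$ l\<close>, which is
    only congruent to 1. This change by a multiple of p is what makes \<open>E\<close> invertible
    over the integers.\<close>
  define E where "E = Abs_fps (\<lambda>n. if n = 0 then 1 else u * d $$ (l + int n))"
  define E' where "E' = fps_right_inverse E 1"
  have "E * E' = 1" unfolding E'_def by (rule fps_right_inverse) (simp add: E_def)
  then have EE: "fps_to_fls E * fps_to_fls E' = 1"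
    by (metis fls_times_fps_to_fls fps_one_to_fls)
  have "int p dvd (fls_const u * fls_shift l d - fps_to_fls E) $$ k" for k
  proof -
    consider "k < 0" | "k = 0" | "0 < k" by linarith
    then show ?thesis
    proof cases
      case 1
      then show ?thesis using below[of "k + l"] by simp
    next
      case 2
      then show ?thesis using u by (simp add: E_def cong_iff_dvd_diff mult.commute)
    qed (simp add: E_def add.commute)
  qed
  then have "of_nat p dvd fls_const u * fls_shift l d - fps_to_fls E"
    unfolding of_nat_dvd_int_fls_iff by blast
  then have "of_nat p dvd (fls_const u * fls_shift l d - fps_to_fls E) * fps_to_fls E'"
    by (rule dvd_mult2)
  also have "(fls_const u * fls_shift l d - fps_to_fls E) * fps_to_fls E'
      = d * (fls_shift l (fls_const u) * fps_to_fls E') - 1"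
  proof -
    have "fls_const u * fls_shift l d * fps_to_fls E' = d * (fls_shift l (fls_const u) * fps_to_fls E')"
      by (simp add: fls_shifted_times_simps mult_ac)
    then show ?thesis by (simp add: left_diff_distrib EE)
  qed
  finally show ?thesis using that by blast
qed

section \<open>Compact open subgroups\<close>

context topological_group
begin

lemma continuous_translation:
  assumes "x \<in> carrier G"
  shows "continuous_map T T (\<lambda>y. x \<otimes> y)"
proof -
  have "continuous_map T (prod_topology T T) (\<lambda>y. (x, y))"
    using assms by (simp add: continuous_map_pairedI topspace_eq)
  from continuous_map_compose[OF this continuous_mult] show ?thesis by (simp add: o_def)
qed

lemma openin_translation_vimage:
  assumes "x \<in> carrier G" "openin T A"
  shows "openin T {y \<in> carrier G. x \<otimes> y \<in> A}"
  using openin_continuous_map_preimage[OF continuous_translation[OF assms(1)] assms(2)]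
  by (simp add: topspace_eq)

lemma open_subgroupI:
  assumes H: "subgroup H G" and A: "openin T A" "a \<in> A" "A \<subseteq> H"
  shows "openin T H"
proof (subst openin_subopen, intro ballI)
  fix h assume h: "h \<in> H"
  have aH: "a \<in> H" and carr: "a \<in> carrier G" "h \<in> carrier G"
    using A h subgroup.mem_carrier[OF H] by auto
  let ?B = "{y \<in> carrier G. (a \<otimes> inv h) \<otimes> y \<in> A}"
  have "openin T ?B" using A(1) carr by (intro openin_translation_vimage) auto
  moreover have "h \<in> ?B" using A(2) carr by (simp add: m_assoc)
  moreover have "?B \<subseteq> H"
  proof
    fix y assume "y \<in> ?B"
    then have y: "y \<in> carrier G" "(a \<otimes> inv h) \<otimes> y \<in> H" using A(3) by auto
    have "inv (a \<otimes> inv h) \<otimes> ((a \<otimes> inv h) \<otimes> y) \<in> H"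
      by (rule subgroup.m_closed[OF H subgroup.m_inv_closed[OF H
            subgroup.m_closed[OF H aH subgroup.m_inv_closed[OF H h]]] y(2)])
    moreover have "inv z \<otimes> (z \<otimes> y) = y" if "z \<in> carrier G" for z
      using y that by (simp add: m_assoc[symmetric])
    ultimately show "y \<in> H" using carr by simp
  qed
  ultimately show "\<exists>B. openin T B \<and> h \<in> B \<and> B \<subseteq> H" by blast
qed

lemma open_subgroup_closed:
  assumes H: "subgroup H G" "openin T H"
  shows "closedin T H"
proof -
  have "openin T (carrier G - H)"
  proof (subst openin_subopen, intro ballI)
    fix x assume x: "x \<in> carrier G - H"
    let ?B = "{y \<in> carrier G. inv x \<otimes> y \<in> H}"
    have "openin T ?B" using x H by (intro openin_translation_vimage) auto
    moreover have "x \<in> ?B" using x subgroup.one_closed[OF H(1)] by simp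
    moreover have "?B \<subseteq> carrier G - H"
    proof safe
      fix y assume y: "y \<in> carrier G" "inv x \<otimes> y \<in> H" "y \<in> H"
      have "y \<otimes> inv (inv x \<otimes> y) \<in> H"
        by (rule subgroup.m_closed[OF H(1) y(3) subgroup.m_inv_closed[OF H(1) y(2)]])
      moreover have "y \<otimes> inv (inv x \<otimes> y) = x"
        using x y by (simp add: inv_mult_group m_assoc[symmetric])
      ultimately show False using x by simp
    qed
    ultimately show "\<exists>B. openin T B \<and> x \<in> B \<and> B \<subseteq> carrier G - H" by blast
  qed
  then show ?thesis using subgroup.subset[OF H(1)] by (simp add: closedin_def topspace_eq)
qed

text \<open>Van Dantzig: the stabiliser of a compact open set is an open subgroup by the tube lemma.\<close>

lemma stabiliser_open_subgroup:
  assumes C: "compactin T C" "openin T C" "\<one> \<in> C"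
  defines "H \<equiv> {x \<in> carrier G. \<forall>c\<in>C. c \<otimes> x \<in> C \<and> c \<otimes> inv x \<in> C}"
  shows "subgroup H G" "openin T H" "H \<subseteq> C"
proof -
  have CG: "C \<subseteq> carrier G" using C(1) compactin_subset_topspace topspace_eq by blast
  show "H \<subseteq> C" 
  proof
    fix x assume "x \<in> H"
    then have "\<one> \<otimes> x \<in> C" "x \<in> carrier G" using C(3) unfolding H_def by blast+
    then show "x \<in> C" by simp
  qed
  show sub: "subgroup H G"
  proof
    fix x y assume xy: "x \<in> H" "y \<in> H"
    then have carr: "x \<in> carrier G" "y \<in> carrier G" unfolding H_def by auto
    have "c \<otimes> (x \<otimes> y) \<in> C \<and> c \<otimes> inv (x \<otimes> y) \<in> C" if c: "c \<in> C" for c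
    proof -
      have "(c \<otimes> x) \<otimes> y \<in> C" "(c \<otimes> inv y) \<otimes> inv x \<in> C" using xy c unfolding H_def by auto
      moreover have "c \<in> carrier G" using c CG by blast
      ultimately show ?thesis using carr by (simp add: m_assoc inv_mult_group)
    qed
    then show "x \<otimes> y \<in> H" using carr unfolding H_def by simp
  next
    fix x assume "x \<in> H"
    then show "inv x \<in> H" unfolding H_def by simp
  next
    have "c \<otimes> \<one> \<in> C" if "c \<in> C" for c using that CG by auto
    then show "\<one> \<in> H" unfolding H_def by simp
  qed (simp add: H_def)
  let ?W = "{z \<in> topspace (prod_topology T T). (\<lambda>(x, y). x \<otimes> y) z \<in> C}"
  have "openin (prod_topology T T) ?W" by (rule openin_continuous_map_preimage[OF continuous_mult C(2)])
  moreover have "C \<times> {\<one>} \<subseteq> ?W" using CG by (auto simp: topspace_eq)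
  ultimately obtain A B where AB: "openin T B" "C \<subseteq> A" "\<one> \<in> B" "A \<times> B \<subseteq> ?W"
    using tube_lemma_left[of T T ?W C \<one>] C(1) by (auto simp: topspace_eq)
  let ?B = "B \<inter> {x \<in> topspace T. inv x \<in> B}"
  have "openin T ?B" using AB(1) by (intro openin_Int openin_continuous_map_preimage[OF continuous_inv])
  moreover have "\<one> \<in> ?B" using AB(3) by (simp add: topspace_eq)
  moreover have "?B \<subseteq> H" 
  proof
    fix x assume x: "x \<in> ?B"
    have "c \<otimes> x \<in> C \<and> c \<otimes> inv x \<in> C" if "c \<in> C" for c
    proof -
      have "(c, x) \<in> ?W" "(c, inv x) \<in> ?W" using that x AB(2,4) by blast+
      then show ?thesis by simp
    qed
    then show "x \<in> H" using x unfolding H_def by (simp add: topspace_eq)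
  qed
  ultimately show "openin T H" using open_subgroupI[OF sub] by blast
qed

text \<open>A compact component of a locally compact Hausdorff space has arbitrarily small clopen
  neighbourhoods, and here the component of the identity is a point. A clopen neighbourhood inside a
  compact set is compact, so its stabiliser is an open subgroup contained in it.\<close>

lemma compact_open_subgroup_in_neighbourhood:
  assumes "locally_compact_space T" "Hausdorff_space T" "totally_disconnected_space T"
    and "openin T A" "\<one> \<in> A"
  obtains H where "subgroup H G" "openin T H" "compactin T H" "H \<subseteq> A"
proof -
  obtain B K where BK: "openin T B" "compactin T K" "\<one> \<in> B" "B \<subseteq> K"
    using assms(1) by (metis locally_compact_space_def one_closed topspace_eq)
  have "connected_component_of_set T \<one> = {\<one>}"
  proof -
    have "connectedin T (connected_component_of_set T \<one>)" by (rule connectedin_connected_component_of)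
    moreover have "\<one> \<in> connected_component_of_set T \<one>"
      by (simp add: connected_component_of_refl topspace_eq)
    ultimately show ?thesis using assms(3) unfolding totally_disconnected_space_def by blast
  qed
  then have "{\<one>} \<in> connected_components_of T"
    by (metis connected_component_in_connected_components_of one_closed topspace_eq)
  then obtain C D where C: "openin T C" "openin T D" "disjnt C D" "C \<union> D = topspace T" "{\<one>} \<subseteq> C" "C \<subseteq> A \<inter> B"
    using wilder_locally_compact_component_thm[of T "{\<one>}" "A \<inter> B"] assms BK
    by (auto simp: topspace_eq)
  have "closedin T C"
  proof -
    have "topspace T - C = D" using C(3,4) by (auto simp: disjnt_def)
    then show ?thesis using C(2,4) by (auto simp: closedin_def)
  qed
  then have "compactin T C" using closed_compactin[OF BK(2)] C(6) BK(4) by blast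
  from stabiliser_open_subgroup[OF this C(1)] C(5)
  have H: "\<exists>H. subgroup H G \<and> openin T H \<and> H \<subseteq> C" by blast
  then obtain H where "subgroup H G" "openin T H" "H \<subseteq> C" by blast
  moreover have "compactin T H"
    using closed_compactin[OF \<open>compactin T C\<close> \<open>H \<subseteq> C\<close>] open_subgroup_closed calculation by blast
  ultimately show thesis using that C(6) by blast
qed

end

section \<open>Contractive automorphisms\<close>

context lc_contraction_group
begin

lemma iter_closed: "x \<in> carrier G \<Longrightarrow> (\<alpha> ^^ n) x \<in> carrier G"
  using automorphism by (induction n) (auto simp: iso_def hom_def)

lemma iter_mult:
  "x \<in> carrier G \<Longrightarrow> y \<in> carrier G \<Longrightarrow> (\<alpha> ^^ n) (x \<otimes> y) = (\<alpha> ^^ n) x \<otimes> (\<alpha> ^^ n) y"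
  using automorphism by (induction n) (auto simp: iso_def hom_def iter_closed)

lemma iter_hom: "group_hom G G (\<alpha> ^^ n)"
  by unfold_locales (auto simp: hom_def iter_closed iter_mult)

lemma iter_homeomorphic: "homeomorphic_map T T (\<alpha> ^^ n)"
proof (induction n)
  case (Suc n)
  then show ?case using homeomorphic_map_compose[OF Suc bicontinuous] by (simp add: o_def)
qed (use homeomorphic_map_id[of T T] in \<open>simp add: id_def\<close>)

lemma iter_continuous: "continuous_map T T (\<alpha> ^^ n)"
  using iter_homeomorphic homeomorphic_imp_continuous_map by blast

lemma iter_inj: "inj_on (\<alpha> ^^ n) (carrier G)"
  using iter_homeomorphic homeomorphic_imp_injective_map topspace_eq by metis

lemma iter_image: "(\<alpha> ^^ n) ` carrier G = carrier G"
  using iter_homeomorphic homeomorphic_imp_surjective_map topspace_eq by metis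

text \<open>For a subgroup \<open>H\<close> this is the largest subgroup of \<open>H\<close> that
  \<alpha> maps into itself.\<close>

definition core :: "'a set \<Rightarrow> 'a set" where
  "core H = {x \<in> carrier G. \<forall>n. (\<alpha> ^^ n) x \<in> H}"

lemma Baire_neighbourhood:
  assumes "\<And>n::nat. closedin T (E n)" "(\<Union>n. E n) = carrier G"
  obtains n A where "openin T A" "A \<noteq> {}" "A \<subseteq> E n"
proof -
  have "T interior_of (\<Union>(range E)) = {}" if "\<And>n. T interior_of (E n) = {}"
    using that assms(1) locally_compact Hausdorff locally_compact_Hausdorff_imp_regular_space
    by (intro Baire_category_alt) auto
  moreover have "T interior_of (\<Union>(range E)) = carrier G"
    using assms(2) topspace_eq interior_of_topspace by metis
  ultimately obtain n where "T interior_of (E n) \<noteq> {}" using one_closed by blast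
  then show thesis by (rule that[OF openin_interior_of _ interior_of_subset])
qed

text \<open>
  The subgroups \<open>\<alpha>\<^sup>-\<^sup>n (core H)\<close> exhaust \<open>G\<close> because \<open>\<alpha>\<close> is contractive, so the core
  is open by Baire's theorem.
\<close>

lemma core_open_subgroup:
  assumes H: "subgroup H G" "openin T H"
  shows core_subgroup: "subgroup (core H) G" and core_open: "openin T (core H)"
    and core_subset: "core H \<subseteq> H" and core_invariant: "\<alpha> ` core H \<subseteq> core H"
    and core_absorbing: "\<And>x. x \<in> carrier G \<Longrightarrow> \<exists>n. (\<alpha> ^^ n) x \<in> core H"
proof -
  show sub: "subgroup (core H) G"
  proof
    fix x y assume "x \<in> core H" "y \<in> core H"
    then show "x \<otimes> y \<in> core H"
      using subgroup.m_closed[OF H(1)] unfolding core_def by (auto simp: iter_mult)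
  next
    fix x assume "x \<in> core H"
    then show "inv x \<in> core H"
      using subgroup.m_inv_closed[OF H(1)] unfolding core_def
      by (auto simp: group_hom.hom_inv[OF iter_hom])
  qed (use subgroup.one_closed[OF H(1)] in \<open>auto simp: core_def group_hom.hom_one[OF iter_hom]\<close>)
  show "core H \<subseteq> H" unfolding core_def by (auto dest: spec[of _ 0])
  show "\<alpha> ` core H \<subseteq> core H"
  proof
    fix y assume "y \<in> \<alpha> ` core H"
    then obtain x where x: "y = \<alpha> x" "x \<in> carrier G" "\<And>n. (\<alpha> ^^ n) x \<in> H"
      unfolding core_def by auto
    have "(\<alpha> ^^ n) y \<in> H" for n using x(3)[of "Suc n"] x(1) by (simp add: funpow_swap1)
    moreover have "y \<in> carrier G" using iter_closed[of x 1] x by simp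
    ultimately show "y \<in> core H" unfolding core_def by simp
  qed
  show abs: "\<exists>n. (\<alpha> ^^ n) x \<in> core H" if x: "x \<in> carrier G" for x
  proof -
    have "\<forall>\<^sub>F n in sequentially. (\<alpha> ^^ n) x \<in> H"
      using contractive[OF x] H(2) subgroup.one_closed[OF H(1)] unfolding limitin_def by blast
    then obtain m where m: "\<And>n. n \<ge> m \<Longrightarrow> (\<alpha> ^^ n) x \<in> H" unfolding eventually_sequentially by blast
    have "(\<alpha> ^^ n) ((\<alpha> ^^ m) x) \<in> H" for n using m[of "n + m"] by (simp add: funpow_add)
    then show ?thesis using iter_closed[OF x] unfolding core_def by blast
  qed
  have cl: "closedin T {x \<in> topspace T. (\<alpha> ^^ n) x \<in> A}" if "closedin T A" for n A
    using iter_continuous that by (rule closedin_continuous_map_preimage)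
  have "closedin T (\<Inter>n. {x \<in> topspace T. (\<alpha> ^^ n) x \<in> H})"
    using cl[OF open_subgroup_closed[OF H]] by (intro closedin_Inter) auto
  also have "(\<Inter>n. {x \<in> topspace T. (\<alpha> ^^ n) x \<in> H}) = core H"
    unfolding core_def topspace_eq by auto
  finally have "closedin T (core H)" .
  have "(\<Union>n. {x \<in> topspace T. (\<alpha> ^^ n) x \<in> core H}) = carrier G" using abs by (auto simp: topspace_eq)
  then obtain n A where A: "openin T A" "A \<noteq> {}" "A \<subseteq> {x \<in> topspace T. (\<alpha> ^^ n) x \<in> core H}"
    by (rule Baire_neighbourhood[OF cl[OF \<open>closedin T (core H)\<close>]])
  then obtain a where "a \<in> A" by blast
  \<comment> \<open>Baire's theorem finds an open set inside a preimage of the core; the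
    homeomorphism \<alpha>^n carries it to an open set inside the core itself.\<close>
  have "openin T ((\<alpha> ^^ n) ` A)"
    using homeomorphic_imp_open_map[OF iter_homeomorphic] A(1) unfolding open_map_def by blast
  then show "openin T (core H)"
    using A(3) \<open>a \<in> A\<close> open_subgroupI[OF sub, of "(\<alpha> ^^ n) ` A" "(\<alpha> ^^ n) a"] by blast
qed

lemma invariant_iter_antimono:
  assumes "\<alpha> ` U \<subseteq> U" "m \<le> n"
  shows "(\<alpha> ^^ n) ` U \<subseteq> (\<alpha> ^^ m) ` U"
  using assms(2)
proof (induction rule: dec_induct)
  case (step n)
  have "(\<alpha> ^^ Suc n) ` U = (\<alpha> ^^ n) ` (\<alpha> ` U)" by (simp add: image_image funpow_swap1)
  also have "\<dots> \<subseteq> (\<alpha> ^^ n) ` U" using assms(1) by blast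
  finally show ?case using step.IH by blast
qed simp

text \<open>Pointwise contraction becomes uniform on compact sets: the preimages \<open>E n\<close>
  of an open invariant subgroup inside \<open>A\<close> form an increasing open cover of
  \<open>K\<close>, so a single one of them contains \<open>K\<close>.\<close>

lemma iter_of_compact_small:
  assumes td: "totally_disconnected_space T"
    and K: "compactin T K" and A: "openin T A" "\<one> \<in> A"
  obtains n where "(\<alpha> ^^ n) ` K \<subseteq> A"
proof -
  obtain H where H: "subgroup H G" "openin T H" "H \<subseteq> A"
    using compact_open_subgroup_in_neighbourhood[OF locally_compact Hausdorff td A] by metis
  define E where "E n = {x \<in> topspace T. (\<alpha> ^^ n) x \<in> core H}" for n
  have "openin T (E n)" for n
    unfolding E_def by (rule openin_continuous_map_preimage[OF iter_continuous core_open[OF H(1,2)]])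
  moreover have "K \<subseteq> \<Union>(range E)"
  proof
    fix x assume "x \<in> K"
    then have "x \<in> carrier G" using K compactin_subset_topspace topspace_eq by blast
    then show "x \<in> \<Union>(range E)" using core_absorbing[OF H(1,2)] by (auto simp: E_def topspace_eq)
  qed
  ultimately obtain \<F> where F: "finite \<F>" "\<F> \<subseteq> range E" "K \<subseteq> \<Union>\<F>"
    using compactinD[OF K, of "range E"] by auto
  obtain M where M: "finite M" "\<F> = E ` M" using F(1,2) finite_subset_image by metis
  have mono: "E m \<subseteq> E n" if "m \<le> n" for m n
  proof
    fix x assume x: "x \<in> E m"
    have "(\<alpha> ^^ (n - m)) ` core H \<subseteq> core H"
      using invariant_iter_antimono[OF core_invariant[OF H(1,2)], of 0 "n - m"] by simp
    then have "(\<alpha> ^^ (n - m)) ((\<alpha> ^^ m) x) \<in> core H" using x unfolding E_def by blast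
    then have "(\<alpha> ^^ n) x \<in> core H" using that by (metis funpow_add o_apply le_add_diff_inverse2)
    then show "x \<in> E n" using x unfolding E_def by simp
  qed
  have "(\<alpha> ^^ Max (insert 0 M)) ` K \<subseteq> A"
  proof safe
    fix x assume "x \<in> K"
    then obtain m where "m \<in> M" "x \<in> E m" using F(3) M(2) by auto
    then have "x \<in> E (Max (insert 0 M))" using mono M(1) by (meson Max_ge finite_insert insertI2 subsetD)
    then show "(\<alpha> ^^ Max (insert 0 M)) x \<in> A"
      using core_subset[OF H(1,2)] H(3) unfolding E_def by blast
  qed
  then show thesis using that by blast
qed

lemma invariant_compact_open_subgroup:
  assumes td: "totally_disconnected_space T"
  obtains U where "subgroup U G" "openin T U" "compactin T U" "\<alpha> ` U \<subseteq> U"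
proof -
  have "openin T (carrier G)" using openin_topspace topspace_eq by metis
  then obtain H where H: "subgroup H G" "openin T H" "compactin T H"
    using compact_open_subgroup_in_neighbourhood[OF locally_compact Hausdorff td] by (metis one_closed)
  note c = core_open_subgroup[OF H(1,2)]
  have "compactin T (core H)"
    using closed_compactin[OF H(3) c(3)] open_subgroup_closed[OF c(1,2)] by blast
  then show thesis using that[of "core H"] c by blast
qed

lemma nat_pow_continuous: "continuous_map T T (\<lambda>x. x [^] (n::nat))"
proof (induction n)
  case 0
  then show ?case by (simp add: topspace_eq)
next
  case (Suc n)
  have "continuous_map T (prod_topology T T) (\<lambda>x. (x [^] n, x))"
    using Suc by (simp add: continuous_map_pairedI)
  from continuous_map_compose[OF this continuous_mult] show ?case by (simp add: o_def)
qed

text \<open>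
  By Baire's theorem some \<open>G[n]\<close> is open; as \<open>\<alpha>\<close> preserves \<open>G[n]\<close> and every orbit enters it,
  \<open>G[n] = G\<close>.
\<close>

lemma finite_exponent:
  assumes "comm_group G" "torsion_group G"
  obtains n :: nat where "0 < n" "\<And>x. x \<in> carrier G \<Longrightarrow> x [^] n = \<one>"
proof -
  interpret comm_group G by fact
  define E where "E n = {x \<in> topspace T. x [^] n \<in> {\<one>}}" for n :: nat
  have "closedin T {\<one>}" using Hausdorff by (simp add: closedin_Hausdorff_singleton topspace_eq)
  then have cl: "closedin T (E n)" for n
    unfolding E_def by (rule closedin_continuous_map_preimage[OF nat_pow_continuous])
  \<comment> \<open>The index starts at 1, because \<open>E 0\<close> is all of G and would yield
    the useless exponent 0.\<close>
  have un: "(\<Union>n. E (Suc n)) = carrier G"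
  proof (intro equalityI subsetI)
    fix x assume "x \<in> carrier G"
    then obtain n :: nat where "0 < n" "x [^] n = \<one>" using assms(2) unfolding torsion_group_def by blast
    then have "x \<in> E (Suc (n - 1))" using \<open>x \<in> carrier G\<close> unfolding E_def topspace_eq by simp
    then show "x \<in> (\<Union>n. E (Suc n))" by blast
  qed (auto simp: E_def topspace_eq)
  obtain m A where A: "openin T A" "A \<noteq> {}" "A \<subseteq> E (Suc m)"
    by (rule Baire_neighbourhood[OF cl un])
  define n where "n = Suc m"
  obtain a where a: "a \<in> A" using A(2) by blast
  have sub: "subgroup (E n) G"
    by standard (auto simp: E_def topspace_eq nat_pow_inv nat_pow_distrib)
  then have "openin T (E n)" using open_subgroupI[OF sub A(1) a] A(3) n_def by blast
  have "x [^] n = \<one>" if x: "x \<in> carrier G" for x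
  proof -
    have "\<forall>\<^sub>F m in sequentially. (\<alpha> ^^ m) x \<in> E n"
      using contractive[OF x] \<open>openin T (E n)\<close> subgroup.one_closed[OF sub] unfolding limitin_def by blast
    then obtain m where "(\<alpha> ^^ m) x \<in> E n" unfolding eventually_sequentially by blast
    then have "(\<alpha> ^^ m) (x [^] n) = (\<alpha> ^^ m) \<one>"
      using x unfolding E_def
      by (simp add: group_hom.hom_nat_pow[OF iter_hom] group_hom.hom_one[OF iter_hom])
    then show ?thesis by (rule inj_onD[OF iter_inj]) (use x in auto)
  qed
  moreover have "0 < n" by (simp add: n_def)
  ultimately show thesis using that by blast
qed

end

section \<open>Integer powers of the automorphism\<close>

context lc_contraction_group
begin

definition \<beta> :: "'a \<Rightarrow> 'a" where
  "\<beta> = inv_into (carrier G) \<alpha>"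

definition apow :: "int \<Rightarrow> 'a \<Rightarrow> 'a" where
  "apow k = (if 0 \<le> k then \<alpha> ^^ nat k else \<beta> ^^ nat (- k))"

lemma alpha_beta: "x \<in> carrier G \<Longrightarrow> \<alpha> (\<beta> x) = x"
  using iter_image[of 1] unfolding \<beta>_def by (simp add: f_inv_into_f)

lemma beta_alpha: "x \<in> carrier G \<Longrightarrow> \<beta> (\<alpha> x) = x"
  using iter_inj[of 1] unfolding \<beta>_def by simp

lemma beta_closed: "x \<in> carrier G \<Longrightarrow> \<beta> x \<in> carrier G"
  using iter_image[of 1] unfolding \<beta>_def by (simp add: inv_into_into)

lemma apow_0 [simp]: "apow 0 x = x"
  by (simp add: apow_def)

lemma apow_of_nat: "apow (int n) = \<alpha> ^^ n"
  by (simp add: apow_def)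

lemma apow_closed [simp]: "x \<in> carrier G \<Longrightarrow> apow k x \<in> carrier G"
proof -
  have "(\<beta> ^^ n) x \<in> carrier G" if "x \<in> carrier G" for n
    using that by (induction n) (auto simp: beta_closed)
  then show "x \<in> carrier G \<Longrightarrow> apow k x \<in> carrier G" by (simp add: apow_def iter_closed)
qed

lemma apow_plus_one: "x \<in> carrier G \<Longrightarrow> apow (k + 1) x = \<alpha> (apow k x)"
proof -
  assume x: "x \<in> carrier G"
  consider (nonneg) "0 \<le> k" | (neg) n where "k = - int (Suc n)"
    by (metis int_cases zero_le_imp_eq_int of_nat_0_le_iff)
  then show ?thesis
  proof cases
    case nonneg
    then have "nat (k + 1) = Suc (nat k)" by simp
    then show ?thesis using nonneg by (simp add: apow_def)
  next
    case neg
    have eq: "apow k x = \<beta> ((\<beta> ^^ n) x)" using neg by (simp add: apow_def nat_add_distrib)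
    have "apow (k + 1) x = (\<beta> ^^ n) x" using neg by (cases n) (simp_all add: apow_def nat_add_distrib)
    moreover have "(\<beta> ^^ n) x \<in> carrier G" using x by (induction n) (auto simp: beta_closed)
    ultimately show ?thesis using eq alpha_beta by simp
  qed
qed

lemma apow_minus_one: "x \<in> carrier G \<Longrightarrow> apow (k - 1) x = \<beta> (apow k x)"
  using apow_plus_one[of x "k - 1"] beta_alpha by simp

lemma apow_add: "x \<in> carrier G \<Longrightarrow> apow (k + l) x = apow k (apow l x)"
proof (induction k rule: int_induct[where k = 0])
  case (step1 i)
  then have "apow (i + 1 + l) x = \<alpha> (apow (i + l) x)"
    using apow_plus_one[of x "i + l"] by (simp add: algebra_simps)
  then show ?case using step1 by (simp add: apow_plus_one)
next
  case (step2 i)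
  then have "apow (i - 1 + l) x = \<beta> (apow (i + l) x)"
    using apow_minus_one[of x "i + l"] by (simp add: algebra_simps)
  then show ?case using step2 by (simp add: apow_minus_one)
qed simp

lemma apow_one: "x \<in> carrier G \<Longrightarrow> apow 1 x = \<alpha> x"
  using apow_plus_one[of x 0] by simp

lemma apow_mult:
  assumes "x \<in> carrier G" "y \<in> carrier G"
  shows "apow k (x \<otimes> y) = apow k x \<otimes> apow k y"
proof (cases "0 \<le> k")
  case True
  then show ?thesis using assms by (simp add: apow_def iter_mult)
next
  case False
  then obtain n where k: "k = - int n" by (metis int_cases2 of_nat_0_le_iff)
  have "apow (int n) (apow k x \<otimes> apow k y) = apow (int n) (apow k x) \<otimes> apow (int n) (apow k y)"
    using assms by (simp add: apow_of_nat iter_mult)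
  also have "\<dots> = x \<otimes> y" using assms k by (simp flip: apow_add)
  finally have "apow k (apow (int n) (apow k x \<otimes> apow k y)) = apow k (x \<otimes> y)" by simp
  then show ?thesis using assms k by (simp flip: apow_add)
qed

lemma apow_hom: "group_hom G G (apow k)"
  by unfold_locales (auto simp: hom_def apow_mult)

lemma apow_one_elt [simp]: "apow k \<one> = \<one>"
  by (rule group_hom.hom_one[OF apow_hom])

lemma apow_inv: "x \<in> carrier G \<Longrightarrow> apow k (inv x) = inv (apow k x)"
  by (rule group_hom.hom_inv[OF apow_hom])

lemma apow_continuous: "continuous_map T T (apow k)"
proof -
  have eq: "homeomorphic_maps T T \<alpha> \<beta>"
  proof -
    obtain g where g: "homeomorphic_maps T T \<alpha> g" using bicontinuous homeomorphic_map_maps by blast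
    have "g x = \<beta> x" if "x \<in> topspace T" for x
    proof -
      have "\<beta> x \<in> topspace T" "x = \<alpha> (\<beta> x)"
        using that beta_closed alpha_beta by (auto simp: topspace_eq)
      then show ?thesis using g unfolding homeomorphic_maps_def by metis
    qed
    then show ?thesis using homeomorphic_maps_eq[OF g] by blast
  qed
  have "continuous_map T T (\<beta> ^^ n)" for n
  proof (induction n)
    case (Suc n)
    then show ?case using continuous_map_compose[OF Suc, of T \<beta>] eq
      by (simp add: homeomorphic_maps_def o_def)
  qed simp
  then show ?thesis by (simp add: apow_def iter_continuous)
qed

end

section \<open>Convergent series in a contraction group\<close>

text \<open>\<open>U\<close> plays the part of a lattice over the ring of integers of a local field,
  with \<alpha> as the uniformizer: its images under \<alpha>^n form a neighbourhood base of the
  identity.\<close>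

locale contraction_lattice = lc_contraction_group G T \<alpha> + comm_group G
  for G (structure) and T \<alpha> +
  fixes U
  assumes U_subgroup: "subgroup U G" and U_open: "openin T U" and U_compact: "compactin T U"
    and U_invariant: "\<alpha> ` U \<subseteq> U"
    and U_small: "openin T A \<Longrightarrow> \<one> \<in> A \<Longrightarrow> \<exists>n. (\<alpha> ^^ n) ` U \<subseteq> A"
begin

text \<open>This is \<alpha>^k U, written as a membership condition so that both signs of k unfold
  alike. The subgroups shrink as k grows.\<close>

definition level :: "int \<Rightarrow> 'a set" where
  "level k = {x \<in> carrier G. apow (- k) x \<in> U}"

lemma level_carrier: "x \<in> level k \<Longrightarrow> x \<in> carrier G"
  by (simp add: level_def)

lemma U_carrier: "x \<in> U \<Longrightarrow> x \<in> carrier G"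
  using subgroup.mem_carrier[OF U_subgroup] .

lemma level_subgroup: "subgroup (level k) G"
  by standard (auto simp: level_def apow_mult apow_inv subgroup.m_closed[OF U_subgroup]
    subgroup.m_inv_closed[OF U_subgroup] subgroup.one_closed[OF U_subgroup])

lemma level_open: "openin T (level k)"
  using openin_continuous_map_preimage[OF apow_continuous U_open] unfolding level_def topspace_eq .

lemma apow_level_iff: "x \<in> carrier G \<Longrightarrow> apow j x \<in> level k \<longleftrightarrow> x \<in> level (k - j)"
  by (simp add: level_def flip: apow_add)

lemma level_image: "level k = apow k ` U"
proof
  show "level k \<subseteq> apow k ` U"
  proof
    fix x assume "x \<in> level k"
    then have "x = apow k (apow (- k) x)" "apow (- k) x \<in> U" by (auto simp: level_def simp flip: apow_add)
    then show "x \<in> apow k ` U" by blast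
  qed
  show "apow k ` U \<subseteq> level k" using U_carrier by (auto simp: level_def simp flip: apow_add)
qed

lemma level_compact: "compactin T (level k)"
  unfolding level_image by (rule image_compactin[OF U_compact apow_continuous])

lemma level_antimono:
  assumes "k \<le> l"
  shows "level l \<subseteq> level k"
proof -
  have step: "level (l + 1) \<subseteq> level l" for l
  proof
    fix x assume x: "x \<in> level (l + 1)"
    then have "\<alpha> (apow (- (l + 1)) x) \<in> U" using U_invariant unfolding level_def by blast
    moreover have "\<alpha> (apow (- (l + 1)) x) = apow (- l) x"
      using apow_plus_one[of x "- (l + 1)"] x by (simp add: level_def)
    ultimately show "x \<in> level l" using x by (simp add: level_def)
  qed
  show ?thesis using assms by (induction l rule: int_ge_induct) (use step in blast)+
qed

lemma level_absorbing:
  assumes "x \<in> carrier G"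
  obtains k where "x \<in> level k"
proof -
  have "\<forall>\<^sub>F n in sequentially. (\<alpha> ^^ n) x \<in> U"
    using contractive[OF assms] U_open subgroup.one_closed[OF U_subgroup] unfolding limitin_def by blast
  then obtain n where "(\<alpha> ^^ n) x \<in> U" unfolding eventually_sequentially by blast
  then have "x \<in> level (- int n)" using assms by (simp add: level_def apow_of_nat)
  then show thesis using that by blast
qed

lemma level_small:
  assumes "openin T A" "\<one> \<in> A"
  obtains k where "level k \<subseteq> A"
  using U_small[OF assms] that unfolding level_image apow_of_nat[symmetric] by blast

lemma level_Inter:
  assumes "\<And>n. m \<le> n \<Longrightarrow> x \<in> level n"
  shows "x = \<one>"
proof (rule ccontr)
  assume "x \<noteq> \<one>"
  have x: "x \<in> carrier G" using assms[of m] level_carrier by simp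
  then have "closedin T {x}" using Hausdorff by (simp add: closedin_Hausdorff_singleton topspace_eq)
  then have "openin T (topspace T - {x})" by blast
  then obtain k where "level k \<subseteq> topspace T - {x}"
    using level_small[of "topspace T - {x}"] \<open>x \<noteq> \<one>\<close> by (auto simp: topspace_eq)
  then show False using assms[of "max m k"] level_antimono[of k "max m k"] by auto
qed

text \<open>All integers below n form an infinite set, over which \<open>finprod\<close> is the
  default value one. Removing the trivial factors leaves a finite set whenever \<open>u\<close> is
  trivial far to the left.\<close>

definition psum :: "(int \<Rightarrow> 'a) \<Rightarrow> int \<Rightarrow> 'a" where
  "psum u n = finprod G u {k. k < n \<and> u k \<noteq> \<one>}"

text \<open>The terms of a Laurent expansion in powers of \<alpha>: the lower bound makes partial
  products finite, and membership in \<open>level k\<close> makes them a Cauchy sequence.\<close>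

definition admissible :: "(int \<Rightarrow> 'a) \<Rightarrow> bool" where
  "admissible u \<longleftrightarrow> (\<forall>k. u k \<in> level k) \<and> (\<exists>m. \<forall>k<m. u k = \<one>)"

lemma admissible_Pi: "admissible u \<Longrightarrow> u \<in> A \<rightarrow> carrier G"
  using level_carrier unfolding admissible_def by blast

lemma psum_eq:
  assumes "admissible u" "\<And>k. k < m \<Longrightarrow> u k = \<one>"
  shows "psum u n = finprod G u {m..<n}"
  unfolding psum_def
proof (rule finprod_mono_neutral_cong_left)
  show "{k. k < n \<and> u k \<noteq> \<one>} \<subseteq> {m..<n}" using assms(2) by (auto simp: not_less[symmetric])
qed (use admissible_Pi[OF assms(1)] in auto)

lemma psum_closed: "admissible u \<Longrightarrow> psum u n \<in> carrier G"
  unfolding psum_def by (rule finprod_closed[OF admissible_Pi])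

lemma psum_below: "\<lbrakk>\<And>k. k < n \<Longrightarrow> u k = \<one>\<rbrakk> \<Longrightarrow> psum u n = \<one>"
  unfolding psum_def by (rule finprod_one_eqI) auto

lemma psum_plus_one:
  assumes "admissible u"
  shows "psum u (n + 1) = psum u n \<otimes> u n"
proof -
  obtain m where m: "\<And>k. k < m \<Longrightarrow> u k = \<one>" using assms unfolding admissible_def by blast
  define l where "l = min m n"
  have l: "\<And>k. k < l \<Longrightarrow> u k = \<one>" using m unfolding l_def by simp
  have "{l..<n + 1} = insert n {l..<n}" unfolding l_def by auto
  moreover have "finprod G u (insert n {l..<n}) = u n \<otimes> finprod G u {l..<n}"
    using admissible_Pi[OF assms, of UNIV] by (intro finprod_insert) auto
  moreover have "finprod G u {l..<n} \<in> carrier G" by (rule finprod_closed[OF admissible_Pi[OF assms]])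
  moreover have "u n \<in> carrier G" using admissible_Pi[OF assms, of UNIV] by auto
  ultimately show ?thesis using m_comm by (simp add: psum_eq[OF assms l])
qed

lemma psum_mult:
  assumes "admissible u" "admissible v" "admissible (\<lambda>k. u k \<otimes> v k)"
  shows "psum (\<lambda>k. u k \<otimes> v k) n = psum u n \<otimes> psum v n"
proof -
  obtain m1 m2 where m: "\<And>k. k < m1 \<Longrightarrow> u k = \<one>" "\<And>k. k < m2 \<Longrightarrow> v k = \<one>"
    using assms unfolding admissible_def by blast
  define l where "l = min m1 m2"
  have l: "\<And>k. k < l \<Longrightarrow> u k = \<one>" "\<And>k. k < l \<Longrightarrow> v k = \<one>" "\<And>k. k < l \<Longrightarrow> u k \<otimes> v k = \<one>"
    using m unfolding l_def by auto
  show ?thesis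
    using admissible_Pi[OF assms(1)] admissible_Pi[OF assms(2)]
    by (simp add: psum_eq[OF assms(1) l(1)] psum_eq[OF assms(2) l(2)] psum_eq[OF assms(3) l(3)])
qed

lemma admissible_mult:
  assumes "admissible u" "admissible v"
  shows "admissible (\<lambda>k. u k \<otimes> v k)"
proof -
  obtain m1 m2 where m: "\<And>k. k < m1 \<Longrightarrow> u k = \<one>" "\<And>k. k < m2 \<Longrightarrow> v k = \<one>"
    using assms unfolding admissible_def by blast
  then have "\<forall>k<min m1 m2. u k \<otimes> v k = \<one>" by simp
  then show ?thesis using assms subgroup.m_closed[OF level_subgroup] unfolding admissible_def by blast
qed

text \<open>Convergence with an explicit rate: the factors with index at least n all lie in
  \<open>level n\<close>, so the error after the first ones does too. This form turns limit
  arguments into computations in subgroups.\<close>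

definition is_sum :: "(int \<Rightarrow> 'a) \<Rightarrow> 'a \<Rightarrow> bool" where
  "is_sum u g \<longleftrightarrow> g \<in> carrier G \<and> (\<forall>n. inv (psum u n) \<otimes> g \<in> level n)"

text \<open>Going back from n + 1 to n restores the factor \<open>u n\<close>, which lies in
  \<open>level n\<close>. Hence the error bound has to be checked only for large n.\<close>

lemma residual_step:
  assumes "admissible u" "g \<in> carrier G" "inv (psum u (n + 1)) \<otimes> g \<in> level (n + 1)"
  shows "inv (psum u n) \<otimes> g \<in> level n"
proof -
  have c: "psum u n \<in> carrier G" "u n \<in> carrier G" "u n \<in> level n"
    using psum_closed[OF assms(1)] assms(1) level_carrier unfolding admissible_def by auto
  have "inv (psum u (n + 1)) \<otimes> g \<in> level n"
    using assms(3) level_antimono[of n "n + 1"] by auto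
  then have "u n \<otimes> (inv (psum u (n + 1)) \<otimes> g) \<in> level n"
    by (rule subgroup.m_closed[OF level_subgroup c(3)])
  also have "u n \<otimes> (inv (psum u (n + 1)) \<otimes> g) = inv (psum u n) \<otimes> g"
  proof -
    have "inv (psum u (n + 1)) = inv (u n) \<otimes> inv (psum u n)"
      using c by (simp add: psum_plus_one[OF assms(1)] inv_mult_group)
    then show ?thesis using c assms(2) by (simp add: m_assoc[symmetric])
  qed
  finally show ?thesis .
qed

lemma is_sumI:
  assumes "admissible u" "g \<in> carrier G" "\<And>n. m \<le> n \<Longrightarrow> inv (psum u n) \<otimes> g \<in> level n"
  shows "is_sum u g"
proof -
  have "inv (psum u n) \<otimes> g \<in> level n" if "n \<le> m" for n
    using that
  proof (induction n rule: int_le_induct)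
    case base
    then show ?case using assms(3) by simp
  next
    case (step i)
    then show ?case using residual_step[OF assms(1,2), of "i - 1"] by simp
  qed
  then show ?thesis using assms unfolding is_sum_def by (meson linear)
qed

lemma is_sum_unique:
  assumes "admissible u" "is_sum u g" "is_sum u h"
  shows "g = h"
proof -
  have c: "g \<in> carrier G" "h \<in> carrier G" using assms unfolding is_sum_def by auto
  have "g \<otimes> inv h \<in> level n" for n
  proof -
    let ?p = "psum u n"
    have p: "?p \<in> carrier G" using psum_closed[OF assms(1)] .
    have "(inv ?p \<otimes> g) \<otimes> inv (inv ?p \<otimes> h) \<in> level n"
      using assms(2,3) unfolding is_sum_def
      by (blast intro: subgroup.m_closed[OF level_subgroup] subgroup.m_inv_closed[OF level_subgroup])
    also have "(inv ?p \<otimes> g) \<otimes> inv (inv ?p \<otimes> h) = g \<otimes> inv h"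
    proof -
      have "(inv ?p \<otimes> g) \<otimes> inv (inv ?p \<otimes> h) = (inv ?p \<otimes> ?p) \<otimes> (g \<otimes> inv h)"
        using p c by (simp add: inv_mult m_ac)
      then show ?thesis using p c by simp
    qed
    finally show ?thesis .
  qed
  then have "g \<otimes> inv h = \<one>" using level_Inter by blast
  then show ?thesis using c by (metis inv_equality inv_inv inv_closed)
qed

text \<open>Each error bound confines the sum to a closed coset of a level. These cosets decrease,
  contain the partial products and lie in the compact set \<open>level m\<close>, so they have a
  common point.\<close>

lemma is_sum_exists:
  assumes "admissible u"
  obtains g where "is_sum u g"
proof -
  obtain m where m: "\<And>k. k < m \<Longrightarrow> u k = \<one>" using assms unfolding admissible_def by blast
  define C where "C n = {g \<in> carrier G. inv (psum u (m + int n)) \<otimes> g \<in> level (m + int n)}" for n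
  have p: "psum u n \<in> carrier G" for n using psum_closed[OF assms] .
  have cl: "closedin T (C n)" for n
    using closedin_continuous_map_preimage[OF continuous_translation open_subgroup_closed[OF level_subgroup level_open]] p
    unfolding C_def topspace_eq by blast
  have "C (Suc n) \<subseteq> C n" for n
  proof
    fix g assume g: "g \<in> C (Suc n)"
    then have "inv (psum u (m + int n + 1)) \<otimes> g \<in> level (m + int n + 1)" "g \<in> carrier G"
      unfolding C_def by (auto simp: algebra_simps)
    then show "g \<in> C n" using residual_step[OF assms] unfolding C_def by blast
  qed
  then have dec: "decseq C" by (rule decseq_SucI)
  have "C 0 = level m" using m psum_below[of m u] level_carrier by (auto simp: C_def)
  then have sub: "C n \<subseteq> level m" for n using dec unfolding decseq_def by (metis le0)
  have "(\<Inter>n. C n) \<noteq> {}"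
  proof (rule compact_space_imp_nest)
    show "compact_space (subtopology T (level m))" by (simp add: compact_space_subtopology level_compact)
    show "closedin (subtopology T (level m)) (C n)" for n by (rule closedin_subset_topspace[OF cl sub])
    have "psum u (m + int n) \<in> C n" for n
      using p subgroup.one_closed[OF level_subgroup] by (simp add: C_def)
    then show "C n \<noteq> {}" for n by blast
  qed (rule dec)
  then obtain g where g: "\<And>n. g \<in> C n" by blast
  have "is_sum u g"
  proof (rule is_sumI[OF assms])
    show "g \<in> carrier G" using g[of 0] unfolding C_def by simp
    show "inv (psum u n) \<otimes> g \<in> level n" if "m \<le> n" for n
      using g[of "nat (n - m)"] that unfolding C_def by simp
  qed
  then show thesis by (rule that)
qed

definition total :: "(int \<Rightarrow> 'a) \<Rightarrow> 'a" where
  "total u = (THE g. is_sum u g)"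

lemma total_eqI: "admissible u \<Longrightarrow> is_sum u g \<Longrightarrow> total u = g"
  unfolding total_def using is_sum_unique by blast

lemma is_sum_total: "admissible u \<Longrightarrow> is_sum u (total u)"
  using is_sum_exists total_eqI by metis

lemma total_closed: "admissible u \<Longrightarrow> total u \<in> carrier G"
  using is_sum_total unfolding is_sum_def by blast

lemma total_mult:
  assumes "admissible u" "admissible v"
  shows "total (\<lambda>k. u k \<otimes> v k) = total u \<otimes> total v"
proof (rule total_eqI[OF admissible_mult[OF assms]])
  show "is_sum (\<lambda>k. u k \<otimes> v k) (total u \<otimes> total v)"
    unfolding is_sum_def
  proof (intro conjI allI)
    note c = total_closed[OF assms(1)] total_closed[OF assms(2)]
    show "total u \<otimes> total v \<in> carrier G" using c by simp
    fix n
    have "(inv (psum u n) \<otimes> total u) \<otimes> (inv (psum v n) \<otimes> total v) \<in> level n"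
      using is_sum_total assms unfolding is_sum_def by (blast intro: subgroup.m_closed[OF level_subgroup])
    moreover have "inv (psum (\<lambda>k. u k \<otimes> v k) n) \<otimes> (total u \<otimes> total v)
        = (inv (psum u n) \<otimes> total u) \<otimes> (inv (psum v n) \<otimes> total v)"
      using c psum_closed[OF assms(1)] psum_closed[OF assms(2)]
      by (simp add: psum_mult[OF assms admissible_mult[OF assms]] inv_mult m_ac)
    ultimately show "inv (psum (\<lambda>k. u k \<otimes> v k) n) \<otimes> (total u \<otimes> total v) \<in> level n" by simp
  qed
qed

lemma total_level:
  assumes "admissible u" "\<And>k. k < m \<Longrightarrow> u k = \<one>"
  shows "total u \<in> level m"
proof -
  have "inv (psum u m) \<otimes> total u \<in> level m" using is_sum_total[OF assms(1)] unfolding is_sum_def by blast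
  then show ?thesis using psum_below[of m u] assms(2) total_closed[OF assms(1)] by simp
qed

lemma admissible_shift:
  assumes "admissible u"
  shows "admissible (\<lambda>k. \<alpha> (u (k - 1)))"
proof -
  obtain m where m: "\<And>k. k < m \<Longrightarrow> u k = \<one>" using assms unfolding admissible_def by blast
  have c: "u k \<in> carrier G" for k using assms level_carrier unfolding admissible_def by blast
  have "\<alpha> (u (k - 1)) \<in> level k" for k
    using assms apow_level_iff[OF c, of 1 "k - 1" k] unfolding admissible_def by (simp add: apow_one[OF c])
  moreover have "\<forall>k<m + 1. \<alpha> (u (k - 1)) = \<one>" using m apow_one[OF one_closed] by simp
  ultimately show ?thesis unfolding admissible_def by blast
qed

lemma psum_shift:
  assumes "admissible u"
  shows "psum (\<lambda>k. \<alpha> (u (k - 1))) (n + 1) = \<alpha> (psum u n)"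
proof -
  let ?w = "\<lambda>k. \<alpha> (u (k - 1))"
  obtain m where m: "\<And>k. k < m \<Longrightarrow> u k = \<one>" using assms unfolding admissible_def by blast
  have a1: "\<alpha> \<one> = \<one>" using apow_one[OF one_closed] by simp
  have c: "u k \<in> carrier G" for k using assms level_carrier unfolding admissible_def by blast
  have small: "psum ?w (n + 1) = \<alpha> (psum u n)" if "n \<le> m" for n
    using m that by (simp add: psum_below a1)
  have "psum ?w (n + 1) = \<alpha> (psum u n)" if "m \<le> n" for n
    using that
  proof (induction n rule: int_ge_induct)
    case base
    show ?case by (rule small) simp
  next
    case (step i)
    then show ?case
      using psum_plus_one[OF admissible_shift[OF assms], of "i + 1"] psum_plus_one[OF assms, of i]
        apow_mult[OF psum_closed[OF assms] c, of 1 i i] c psum_closed[OF assms]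
      by (simp add: apow_one)
  qed
  then show ?thesis using small by (meson linear)
qed

text \<open>\<alpha> moves partial products and error bounds alike by one index, from
  \<open>level (n - 1)\<close> to \<open>level n\<close>.\<close>

lemma total_shift:
  assumes "admissible u"
  shows "total (\<lambda>k. \<alpha> (u (k - 1))) = \<alpha> (total u)"
proof (rule total_eqI[OF admissible_shift[OF assms]])
  note c = total_closed[OF assms] psum_closed[OF assms]
  have "inv (psum (\<lambda>k. \<alpha> (u (k - 1))) n) \<otimes> \<alpha> (total u) \<in> level n" for n
  proof -
    have "inv (psum (\<lambda>k. \<alpha> (u (k - 1))) n) \<otimes> \<alpha> (total u) = apow 1 (inv (psum u (n - 1)) \<otimes> total u)"
      using psum_shift[OF assms, of "n - 1"] c by (simp add: apow_mult apow_inv apow_one)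
    moreover have "apow 1 (inv (psum u (n - 1)) \<otimes> total u) \<in> level n"
      using is_sum_total[OF assms] c unfolding is_sum_def by (subst apow_level_iff) auto
    ultimately show ?thesis by simp
  qed
  moreover have "\<alpha> (total u) \<in> carrier G" using apow_closed[OF c(1), of 1] c by (simp add: apow_one)
  ultimately show "is_sum (\<lambda>k. \<alpha> (u (k - 1))) (\<alpha> (total u))" unfolding is_sum_def by blast
qed

end

section \<open>Presentation over Laurent series\<close>

text \<open>Bounds are expressed by vanishing coefficients, not by subdegrees, because the subdegree
  of the zero series is 0 by convention and would give a wrong bound.\<close>

lemma fls_mult_vanishes_below:
  fixes f g :: "int fls"
  assumes "\<And>k. k < a \<Longrightarrow> f $$ k = 0" "\<And>k. k < b \<Longrightarrow> g $$ k = 0" "k < a + b"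
  shows "(f * g) $$ k = 0"
proof (cases "f = 0 \<or> g = 0")
  case False
  then have "a \<le> fls_subdegree f" "b \<le> fls_subdegree g"
    using assms by (auto intro: fls_subdegree_geI)
  then show ?thesis using assms(3) by (intro fls_times_nth_eq0) simp
qed auto

lemma sum_fun_apply: "(\<Sum>i\<in>A. f i) r = (\<Sum>i\<in>A. f i r)"
  by (induction A rule: infinite_finite_induct) auto

definition fls_scale :: "int fls \<Rightarrow> ('i \<Rightarrow> int fls) \<Rightarrow> 'i \<Rightarrow> int fls" where
  "fls_scale c v = (\<lambda>r. c * v r)"

lemma fls_scale_apply [simp]: "fls_scale c v r = c * v r"
  by (simp add: fls_scale_def)

interpretation fls_module: Modules.module fls_scale
  by unfold_locales (auto simp: fls_scale_def fun_eq_iff algebra_simps)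

definition fls_trunc :: "int \<Rightarrow> int fls \<Rightarrow> int fls" where
  "fls_trunc n c = Abs_fls (\<lambda>k. if k < n then c $$ k else 0)"

lemma fls_trunc_nth [simp]: "fls_trunc n c $$ k = (if k < n then c $$ k else 0)"
proof -
  obtain m where "\<And>k. k < m \<Longrightarrow> c $$ k = 0" using fls_nth_vanishes_belowE by blast
  then show ?thesis unfolding fls_trunc_def by (intro nth_Abs_fls_lower_bound[of m]) auto
qed

lemma fls_trunc_plus_one: "fls_trunc (n + 1) c = fls_trunc n c + of_int (c $$ n) * fls_shift (- n) 1"
  by (intro fls_eqI) auto

lemma (in comm_group) finprod_subgroup_closed:
  assumes "subgroup H G" "\<And>i. i \<in> A \<Longrightarrow> f i \<in> H"
  shows "finprod G f A \<in> H"
  using assms(2)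
proof (induction A rule: infinite_finite_induct)
  case (insert x A)
  then have "f \<in> A \<rightarrow> carrier G" "f x \<in> carrier G" using subgroup.mem_carrier[OF assms(1)] by auto
  then show ?case using insert subgroup.m_closed[OF assms(1)] by simp
qed (auto simp: subgroup.one_closed[OF assms(1)])

text \<open>\<open>R\<close> is a set of digits for expansions in base \<alpha>. A residue may have
  several representatives in \<open>R\<close>; the resulting ambiguity is absorbed by the kernel
  \<open>N\<close>.\<close>

locale presented_lattice = contraction_lattice +
  fixes R :: "'a set" and e :: nat
  assumes R_finite: "finite R" and R_subset: "R \<subseteq> U"
    and R_residues: "u \<in> U \<Longrightarrow> \<exists>r\<in>R. \<exists>w\<in>U. u = r \<otimes> \<alpha> w"
    and e_pos: "0 < e" and e_exponent: "x \<in> carrier G \<Longrightarrow> x [^] e = \<one>"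
begin

definition coef_term :: "('a \<Rightarrow> int fls) \<Rightarrow> int \<Rightarrow> 'a" where
  "coef_term v k = apow k (\<Otimes>r\<in>R. r [^] (v r $$ k))"

text \<open>Additively, this is the sum of \<open>v r $$ k\<close> times \<alpha>^k r over all k and
  all r in \<open>R\<close>. Coordinates outside \<open>R\<close> are ignored, so functions on the
  whole type can model the free module on \<open>R\<close>.\<close>

definition \<Phi> :: "('a \<Rightarrow> int fls) \<Rightarrow> 'a" where
  "\<Phi> v = total (coef_term v)"

lemma R_pow_closed: "r \<in> R \<Longrightarrow> r [^] (n::int) \<in> carrier G"
  using R_subset U_carrier by blast

lemma coef_product_closed: "(\<Otimes>r\<in>R. r [^] (f r :: int)) \<in> U"
  using R_subset by (intro finprod_subgroup_closed[OF U_subgroup] subgroup_int_pow_closed[OF U_subgroup]) auto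

definition vanishes_below :: "int \<Rightarrow> ('a \<Rightarrow> int fls) \<Rightarrow> bool" where
  "vanishes_below m v \<longleftrightarrow> (\<forall>r\<in>R. \<forall>k<m. v r $$ k = 0)"

lemma coef_term_vanishes: "vanishes_below m v \<Longrightarrow> k < m \<Longrightarrow> coef_term v k = \<one>"
  unfolding coef_term_def vanishes_below_def by (subst finprod_one_eqI) auto

lemma vanishes_below_exists: obtains m where "vanishes_below m v"
proof -
  have "\<forall>r. \<exists>m. \<forall>k<m. v r $$ k = 0" by (metis fls_nth_vanishes_belowE)
  then obtain f where f: "\<And>r k. k < f r \<Longrightarrow> v r $$ k = 0" by metis
  have "vanishes_below (Min (insert 0 (f ` R))) v"
    unfolding vanishes_below_def using R_finite by (auto intro!: f)
  then show thesis by (rule that)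
qed

lemma admissible_coef_term: "admissible (coef_term v)"
proof -
  obtain m where "vanishes_below m v" by (rule vanishes_below_exists)
  then have "\<forall>k<m. coef_term v k = \<one>" using coef_term_vanishes by blast
  moreover have "coef_term v k \<in> level k" for k
    unfolding coef_term_def level_image by (rule imageI[OF coef_product_closed])
  ultimately show ?thesis unfolding admissible_def by blast
qed

lemma \<Phi>_closed [simp]: "\<Phi> v \<in> carrier G"
  unfolding \<Phi>_def by (rule total_closed[OF admissible_coef_term])

lemma \<Phi>_level: "vanishes_below m v \<Longrightarrow> \<Phi> v \<in> level m"
  unfolding \<Phi>_def by (rule total_level[OF admissible_coef_term coef_term_vanishes])

lemma \<Phi>_vanishing:
  assumes "\<And>r. r \<in> R \<Longrightarrow> v r = 0"
  shows "\<Phi> v = \<one>"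
proof (rule level_Inter)
  show "\<Phi> v \<in> level n" for n using assms by (intro \<Phi>_level) (auto simp: vanishes_below_def)
qed

lemma \<Phi>_zero [simp]: "\<Phi> 0 = \<one>"
  by (rule \<Phi>_vanishing) simp

lemma \<Phi>_add: "\<Phi> (v + w) = \<Phi> v \<otimes> \<Phi> w"
proof -
  have "coef_term (v + w) k = coef_term v k \<otimes> coef_term w k" for k
  proof -
    have "(\<Otimes>r\<in>R. r [^] ((v + w) r $$ k)) = (\<Otimes>r\<in>R. r [^] (v r $$ k) \<otimes> r [^] (w r $$ k))"
      using R_subset U_carrier by (intro finprod_cong') (auto simp: int_pow_mult)
    also have "\<dots> = (\<Otimes>r\<in>R. r [^] (v r $$ k)) \<otimes> (\<Otimes>r\<in>R. r [^] (w r $$ k))"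
      using R_pow_closed by (intro finprod_multf) auto
    finally show ?thesis
      unfolding coef_term_def using coef_product_closed U_carrier by (simp add: apow_mult)
  qed
  then have "coef_term (v + w) = (\<lambda>k. coef_term v k \<otimes> coef_term w k)" by auto
  then show ?thesis unfolding \<Phi>_def by (simp add: total_mult admissible_coef_term)
qed

lemma \<Phi>_minus: "\<Phi> (- v) = inv (\<Phi> v)"
  using \<Phi>_add[of "- v" v] by (simp add: inv_equality)

lemma \<Phi>_diff: "\<Phi> (v - w) = \<Phi> v \<otimes> inv (\<Phi> w)"
  using \<Phi>_add[of v "- w"] \<Phi>_minus by simp

lemma \<Phi>_of_nat: "\<Phi> (fls_scale (of_nat n) v) = \<Phi> v [^] n"
proof (induction n)
  case (Suc n)
  have "fls_scale (of_nat (Suc n)) v = fls_scale (of_nat n) v + v"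
    by (auto simp: fun_eq_iff algebra_simps)
  then have "\<Phi> (fls_scale (of_nat (Suc n)) v) = \<Phi> (fls_scale (of_nat n) v) \<otimes> \<Phi> v"
    by (simp only: \<Phi>_add)
  then show ?case by (simp only: Suc nat_pow_Suc)
qed (simp add: \<Phi>_vanishing)

lemma \<Phi>_shift: "\<Phi> (fls_scale fls_X v) = \<alpha> (\<Phi> v)"
proof -
  have "coef_term (fls_scale fls_X v) k = \<alpha> (coef_term v (k - 1))" for k
    using coef_product_closed U_carrier apow_plus_one[of _ "k - 1"]
    by (simp add: coef_term_def fls_X_times_conv_shift)
  then have "coef_term (fls_scale fls_X v) = (\<lambda>k. \<alpha> (coef_term v (k - 1)))" by auto
  then show ?thesis unfolding \<Phi>_def by (simp add: total_shift admissible_coef_term)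
qed

text \<open>X acts as the injective map \<alpha>, so multiplication by X and by its inverse both
  preserve the kernel of \<Phi>.\<close>

lemma \<Phi>_eq_one_shift_iff: "\<Phi> (fls_scale (fls_shift (- k) 1) v) = \<one> \<longleftrightarrow> \<Phi> v = \<one>"
proof -
  have step: "\<Phi> (fls_scale (fls_shift (- (k + 1)) 1) v) = \<one> \<longleftrightarrow> \<Phi> (fls_scale (fls_shift (- k) 1) v) = \<one>" for k
  proof -
    have "fls_shift (- (k + 1)) 1 = (fls_X * fls_shift (- k) 1 :: int fls)"
      by (simp add: fls_X_times_conv_shift)
    then have "fls_scale (fls_shift (- (k + 1)) 1) v = fls_scale fls_X (fls_scale (fls_shift (- k) 1) v)"
      by (simp add: fls_scale_def mult.assoc)
    then have eq: "\<Phi> (fls_scale (fls_shift (- (k + 1)) 1) v) = \<alpha> (\<Phi> (fls_scale (fls_shift (- k) 1) v))"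
      by (simp only: \<Phi>_shift)
    have "\<alpha> \<one> = \<one>" using apow_one[OF one_closed] by simp
    then show ?thesis unfolding eq using inj_onD[OF iter_inj[of 1], of "\<Phi> _" \<one>] by auto
  qed
  show ?thesis
  proof (induction k rule: int_induct[where k = 0])
    case base
    show ?case by simp
  next
    case (step1 i)
    then show ?case using step[of i] by blast
  next
    case (step2 i)
    then show ?case using step[of "i - 1", unfolded diff_add_cancel] by blast
  qed
qed

definition N :: "('a \<Rightarrow> int fls) set" where
  "N = {v. \<Phi> v = \<one>}"

lemma N_of_int:
  assumes "v \<in> N"
  shows "fls_scale (of_int a) v \<in> N"
proof -
  have "fls_scale (of_nat n) v \<in> N" for n using assms by (simp add: N_def \<Phi>_of_nat)
  moreover have "fls_scale (- c) v = - fls_scale c v" for c by (simp add: fls_module.scale_minus_left)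
  ultimately show ?thesis
    by (cases a rule: int_cases2) (auto simp: N_def \<Phi>_minus)
qed

text \<open>
  Closedness of \<open>N\<close> under multiplication by a Laurent series follows from the case of Laurent
  polynomials, because \<open>\<Phi>\<close> sends tails into small neighbourhoods of the identity.
\<close>

lemma N_subspace: "fls_module.subspace N"
proof (rule fls_module.subspaceI)
  show "0 \<in> N" by (simp add: N_def)
  show add: "v + w \<in> N" if "v \<in> N" "w \<in> N" for v w using that by (simp add: N_def \<Phi>_add)
  show "fls_scale c v \<in> N" if v: "v \<in> N" for c v
  proof -
    obtain m where m: "vanishes_below m v" by (rule vanishes_below_exists)
    obtain l where l: "\<And>k. k < l \<Longrightarrow> c $$ k = 0" using fls_nth_vanishes_belowE by blast
    \<comment> \<open>The truncation at l is zero, and each further coefficient adds an integer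
      multiple of a shift of v, which stays in \<open>N\<close>.\<close>
    have trunc: "fls_scale (fls_trunc n c) v \<in> N" if "l \<le> n" for n
      using that
    proof (induction n rule: int_ge_induct)
      case base
      have "fls_trunc l c = 0" using l by (intro fls_eqI) auto
      then show ?case by (simp add: N_def \<Phi>_vanishing)
    next
      case (step n)
      have "fls_scale (fls_trunc (n + 1) c) v = fls_scale (fls_trunc n c) v
          + fls_scale (of_int (c $$ n)) (fls_scale (fls_shift (- n) 1) v)"
        by (simp add: fls_trunc_plus_one fls_module.scale_left_distrib)
      moreover have "fls_scale (fls_shift (- n) 1) v \<in> N"
        using v by (simp add: N_def \<Phi>_eq_one_shift_iff)
      ultimately show ?case using add[OF step(2) N_of_int] by (simp only:)
    qed
    have "\<Phi> (fls_scale c v) \<in> level n" if "l + m \<le> n" for n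
    proof -
      \<comment> \<open>Since v starts at m, cutting c at n - m makes the tail times v start at
        n.\<close>
      define d where "d = c - fls_trunc (n - m) c"
      have "vanishes_below n (fls_scale d v)"
        unfolding vanishes_below_def
      proof (intro ballI allI impI)
        fix r k assume "r \<in> R" "k < n"
        then show "fls_scale d v r $$ k = 0"
          using m fls_mult_vanishes_below[of "n - m" d m "v r" k]
          by (auto simp: d_def vanishes_below_def)
      qed
      then have "\<Phi> (fls_scale d v) \<in> level n" by (rule \<Phi>_level)
      moreover have "fls_scale c v = fls_scale (fls_trunc (n - m) c) v + fls_scale d v"
        by (simp add: d_def fls_module.scale_left_distrib[symmetric])
      moreover have "\<Phi> (fls_scale (fls_trunc (n - m) c) v) = \<one>" using trunc[of "n - m"] that by (simp add: N_def)
      ultimately show ?thesis by (simp add: \<Phi>_add)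
    qed
    then show ?thesis unfolding N_def using level_Inter by blast
  qed
qed

sublocale quotient: torsion_quotient fls_scale N e
proof unfold_locales
  show "fls_module.subspace N" by (rule N_subspace)
  show "fls_scale (of_nat e) v \<in> N" for v by (simp only: N_def mem_Collect_eq \<Phi>_of_nat e_exponent[OF \<Phi>_closed])
  show "of_nat p dvd d \<or> (\<exists>d'. of_nat p dvd d * d' - 1)" if "prime p" for p and d :: "int fls"
    using int_fls_unit_mod_prime[OF that] by blast
qed (rule e_pos)

text \<open>Digit expansion in base \<alpha>: \<rho> picks the digit of an element of
  \<open>U\<close> and \<sigma> the remainder to be expanded next. The coefficient of X^k in
  \<open>v r\<close> is 1 if r is the k-th digit and 0 otherwise. That v starts where the level does
  is used for openness later.\<close>

lemma \<Phi>_onto_level: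
  assumes g: "g \<in> level m"
  obtains v where "vanishes_below m v" "\<Phi> v = g"
proof -
  obtain \<rho> \<sigma> where rs: "\<And>u. u \<in> U \<Longrightarrow> \<rho> u \<in> R \<and> \<sigma> u \<in> U \<and> u = \<rho> u \<otimes> \<alpha> (\<sigma> u)"
    using R_residues by metis
  define w where "w k = (\<sigma> ^^ nat (k - m)) (apow (- m) g)" for k
  have wU: "w k \<in> U" for k
  proof -
    have "(\<sigma> ^^ n) (apow (- m) g) \<in> U" for n
      using g rs by (induction n) (auto simp: level_def)
    then show ?thesis by (simp add: w_def)
  qed
  have w_step: "w (k + 1) = \<sigma> (w k)" if "m \<le> k" for k
  proof -
    have "nat (k + 1 - m) = Suc (nat (k - m))" using that by simp
    then show ?thesis unfolding w_def by simp
  qed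
  define v where "v r = Abs_fls (\<lambda>k. if m \<le> k \<and> \<rho> (w k) = r then 1 else 0 :: int)" for r
  have v_nth: "v r $$ k = (if m \<le> k \<and> \<rho> (w k) = r then 1 else 0)" for r k
    unfolding v_def by (rule nth_Abs_fls_lower_bound[of m]) auto
  have vb: "vanishes_below m v" by (simp add: vanishes_below_def v_nth)
  have carr: "\<rho> (w k) \<in> carrier G" "\<sigma> (w k) \<in> carrier G" "w k \<in> carrier G" for k
    using rs[OF wU] wU R_subset U_carrier by auto
  have ct: "coef_term v k = apow k (\<rho> (w k))" if "m \<le> k" for k
  proof -
    have "(\<Otimes>r\<in>R. r [^] (v r $$ k)) = (\<Otimes>r\<in>R. if \<rho> (w k) = r then r else \<one>)"
      using that R_subset U_carrier by (intro finprod_cong') (auto simp: v_nth)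
    also have "\<dots> = \<rho> (w k)"
      using finprod_singleton[of "\<rho> (w k)" R "\<lambda>r. r"] rs[OF wU] R_finite R_subset U_carrier by auto
    finally show ?thesis by (simp add: coef_term_def)
  qed
  have gc: "g \<in> carrier G" using g level_carrier by blast
  \<comment> \<open>Invariant of the expansion: g is the part already expanded times the remainder
    \<open>w n\<close>, moved to its place by \<alpha>^n.\<close>
  have res: "g = psum (coef_term v) n \<otimes> apow n (w n)" if "m \<le> n" for n
    using that
  proof (induction n rule: int_ge_induct)
    case base
    have "psum (coef_term v) m = \<one>" using coef_term_vanishes[OF vb] by (intro psum_below)
    then show ?case using gc by (simp add: w_def flip: apow_add)
  next
    case (step n)
    have "apow n (w n) = apow n (\<rho> (w n)) \<otimes> apow n (\<alpha> (\<sigma> (w n)))"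
      using rs[OF wU, of n] apow_mult[of "\<rho> (w n)" "\<alpha> (\<sigma> (w n))" n] carr apow_closed[of "\<sigma> (w n)" 1]
      by (simp add: apow_one)
    also have "apow n (\<alpha> (\<sigma> (w n))) = apow (n + 1) (w (n + 1))"
      using w_step[OF step(1)] carr apow_add[of "\<sigma> (w n)" n 1] by (simp add: apow_one)
    finally have "apow n (w n) = coef_term v n \<otimes> apow (n + 1) (w (n + 1))" using ct[OF step(1)] by simp
    moreover have "coef_term v n \<in> carrier G" using ct[OF step(1)] carr by simp
    ultimately have "g = psum (coef_term v) n \<otimes> coef_term v n \<otimes> apow (n + 1) (w (n + 1))"
      using step(2) psum_closed[OF admissible_coef_term, of v n] carr by (simp add: m_assoc)
    then show ?case by (simp add: psum_plus_one[OF admissible_coef_term])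
  qed
  have "is_sum (coef_term v) g"
  proof (rule is_sumI[OF admissible_coef_term gc])
    fix n assume "m \<le> n"
    note p = psum_closed[OF admissible_coef_term, of v n]
    have "inv (psum (coef_term v) n) \<otimes> g = apow n (w n)"
      using res[OF \<open>m \<le> n\<close>] p carr by (simp add: m_assoc[symmetric])
    then show "inv (psum (coef_term v) n) \<otimes> g \<in> level n" using wU by (simp add: level_image)
  qed
  then have "\<Phi> v = g" unfolding \<Phi>_def by (rule total_eqI[OF admissible_coef_term])
  with vb show thesis by (rule that)
qed

definition unit_vec :: "'a \<Rightarrow> 'a \<Rightarrow> int fls" where
  "unit_vec r = (\<lambda>s. if s = r then 1 else 0)"

text \<open>The finite combination reproduces v on \<open>R\<close>; the coordinates elsewhere are
  invisible to \<Phi>.\<close>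

lemma minus_unit_combination_in_N: "v - (\<Sum>r\<in>R. fls_scale (v r) (unit_vec r)) \<in> N"
proof -
  have "(\<Sum>r\<in>R. fls_scale (v r) (unit_vec r)) s = v s" if "s \<in> R" for s
  proof -
    have "(\<Sum>r\<in>R. fls_scale (v r) (unit_vec r)) s = (\<Sum>r\<in>R. fls_scale (v r) (unit_vec r) s)"
      by (rule sum_fun_apply)
    also have "\<dots> = (\<Sum>r\<in>R. if s = r then v r else 0)" by (intro sum.cong) (auto simp: unit_vec_def)
    finally show ?thesis using that R_finite by simp
  qed
  then show ?thesis unfolding N_def by (auto intro!: \<Phi>_vanishing)
qed

lemma span_unit_vec_N: "fls_module.span (unit_vec ` R \<union> N) = UNIV"
proof -
  have "v \<in> fls_module.span (unit_vec ` R \<union> N)" for v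
  proof -
    have "(\<Sum>r\<in>R. fls_scale (v r) (unit_vec r)) \<in> fls_module.span (unit_vec ` R \<union> N)"
      by (intro fls_module.span_sum fls_module.span_scale fls_module.span_base) auto
    moreover have "v - (\<Sum>r\<in>R. fls_scale (v r) (unit_vec r)) \<in> fls_module.span (unit_vec ` R \<union> N)"
      using minus_unit_combination_in_N by (intro fls_module.span_base) auto
    ultimately show ?thesis by (metis fls_module.span_add diff_add_cancel)
  qed
  then show ?thesis by auto
qed

end

section \<open>The shift on two-sided sequences\<close>

definition of_two_sided :: "(int \<Rightarrow> 'a) \<Rightarrow> (int \<Rightarrow> 'a) \<times> (int \<Rightarrow> 'a)" where
  "of_two_sided f = (restrict f {..<0}, restrict f {0..})"

lemma two_sided_of_two_sided [simp]: "two_sided (of_two_sided f) = f"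
  by (auto simp: two_sided_def of_two_sided_def fun_eq_iff)

lemma two_sided_right_shift [simp]: "two_sided (right_shift p) n = two_sided p (n - 1)"
  by (simp add: right_shift_def two_sided_def)

lemma two_sided_right_shift_iter: "two_sided ((right_shift ^^ m) p) n = two_sided p (n - int m)"
  by (induction m arbitrary: n) (simp_all add: algebra_simps)

locale finite_comm_group = comm_group F for F (structure) +
  assumes finite_carrier: "finite (carrier F)"
begin

lemma carrier_shift_group:
  "carrier (shift_group F) = {x \<in> {..<0} \<rightarrow>\<^sub>E carrier F. finite {i \<in> {..<0}. x i \<noteq> \<one>}} \<times> ({0..} \<rightarrow>\<^sub>E carrier F)"
  unfolding shift_group_def by (simp add: carrier_sum_group)

lemma two_sided_closed: "p \<in> carrier (shift_group F) \<Longrightarrow> two_sided p n \<in> carrier F"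
  by (auto simp: carrier_shift_group two_sided_def)

lemma two_sided_bounded_below:
  assumes "p \<in> carrier (shift_group F)"
  obtains m where "\<And>n. n < m \<Longrightarrow> two_sided p n = \<one>"
proof -
  have fin: "finite {i \<in> {..<0}. fst p i \<noteq> \<one>}" using assms by (auto simp: carrier_shift_group)
  have "two_sided p n = \<one>" if "n < Min (insert 0 {i \<in> {..<0}. fst p i \<noteq> \<one>})" for n
    using that fin by (auto simp: two_sided_def)
  then show thesis by (rule that)
qed

lemma of_two_sided_mem:
  assumes "\<And>n. f n \<in> carrier F" "\<And>n. n < m \<Longrightarrow> f n = \<one>"
  shows "of_two_sided f \<in> carrier (shift_group F)"
proof -
  have "{i \<in> {..<0}. restrict f {..<0} i \<noteq> \<one>} \<subseteq> {m..<0}" using assms(2) by (auto simp: not_less[symmetric])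
  then have "finite {i \<in> {..<0}. restrict f {..<0} i \<noteq> \<one>}" by (rule finite_subset) simp
  then show ?thesis using assms(1) by (auto simp: carrier_shift_group of_two_sided_def)
qed

lemma shift_group_eqI:
  assumes "p \<in> carrier (shift_group F)" "q \<in> carrier (shift_group F)" "\<And>n. two_sided p n = two_sided q n"
  shows "p = q"
proof (rule prod_eqI)
  show "fst p = fst q"
  proof (rule PiE_ext)
    show "fst p \<in> {..<0} \<rightarrow>\<^sub>E carrier F" "fst q \<in> {..<0} \<rightarrow>\<^sub>E carrier F"
      using assms(1,2) by (auto simp: carrier_shift_group)
    show "fst p n = fst q n" if "n \<in> {..<0}" for n using assms(3)[of n] that by (simp add: two_sided_def)
  qed
  show "snd p = snd q"
  proof (rule PiE_ext)
    show "snd p \<in> {0..} \<rightarrow>\<^sub>E carrier F" "snd q \<in> {0..} \<rightarrow>\<^sub>E carrier F"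
      using assms(1,2) by (auto simp: carrier_shift_group)
    show "snd p n = snd q n" if "n \<in> {0..}" for n using assms(3)[of n] that by (simp add: two_sided_def)
  qed
qed

lemma two_sided_mult [simp]:
  "two_sided (p \<otimes>\<^bsub>shift_group F\<^esub> q) n = two_sided p n \<otimes> two_sided q n"
  by (cases p; cases q) (simp add: shift_group_def two_sided_def)

lemma two_sided_one [simp]: "two_sided \<one>\<^bsub>shift_group F\<^esub> n = \<one>"
  by (simp add: shift_group_def two_sided_def)

lemma group_shift_group: "group (shift_group F)"
  unfolding shift_group_def by (intro DirProd_group) auto

lemma comm_group_shift_group: "comm_group (shift_group F)"
proof -
  interpret S: group "shift_group F" by (rule group_shift_group)
  show ?thesis
  proof (rule S.group_comm_groupI)
    fix p q assume "p \<in> carrier (shift_group F)" "q \<in> carrier (shift_group F)"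
    then show "p \<otimes>\<^bsub>shift_group F\<^esub> q = q \<otimes>\<^bsub>shift_group F\<^esub> p"
      by (intro shift_group_eqI) (auto simp: m_comm two_sided_closed)
  qed
qed

lemma two_sided_inv:
  assumes "p \<in> carrier (shift_group F)"
  shows "two_sided (inv\<^bsub>shift_group F\<^esub> p) n = inv (two_sided p n)"
proof -
  interpret S: group "shift_group F" by (rule group_shift_group)
  have "two_sided (inv\<^bsub>shift_group F\<^esub> p) n \<otimes> two_sided p n = \<one>"
    using S.l_inv[OF assms] two_sided_mult two_sided_one by metis
  then show ?thesis using assms two_sided_closed by (metis S.inv_closed inv_equality)
qed

lemma torsion_shift_group: "torsion_group (shift_group F)"
proof -
  interpret S: group "shift_group F" by (rule group_shift_group)
  have "p [^]\<^bsub>shift_group F\<^esub> order F = \<one>\<^bsub>shift_group F\<^esub>" if p: "p \<in> carrier (shift_group F)" for p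
  proof (rule shift_group_eqI)
    fix n
    have "two_sided (p [^]\<^bsub>shift_group F\<^esub> k) n = two_sided p n [^] k" for k :: nat
      by (induction k) simp_all
    then show "two_sided (p [^]\<^bsub>shift_group F\<^esub> order F) n = two_sided \<one>\<^bsub>shift_group F\<^esub> n"
      using two_sided_closed[OF p] by (simp add: pow_order_eq_1)
  qed (use p in auto)
  moreover have "0 < order F" using finite_carrier order_gt_0_iff_finite by blast
  ultimately show ?thesis unfolding torsion_group_def using group_shift_group by blast
qed

lemma topspace_shift_topology [simp]: "topspace (shift_topology F) = carrier (shift_group F)"
  by (simp add: shift_topology_def shift_group_def)

text \<open>For n at least 0 this fixes the whole discrete component and the first n entries of the
  compact one, so one formula gives basic neighbourhoods of the product.\<close>

definition agree_below :: "int \<Rightarrow> (int \<Rightarrow> 'a) \<times> (int \<Rightarrow> 'a) \<Rightarrow> ((int \<Rightarrow> 'a) \<times> (int \<Rightarrow> 'a)) set" where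
  "agree_below n p = {q \<in> carrier (shift_group F). \<forall>k<n. two_sided q k = two_sided p k}"

lemma openin_shift_topology_iff:
  "openin (shift_topology F) A \<longleftrightarrow>
     A \<subseteq> carrier (shift_group F) \<and> (\<forall>p\<in>A. \<exists>n. agree_below n p \<subseteq> A)"
proof (intro iffI conjI ballI)
  assume A: "openin (shift_topology F) A"
  show sub: "A \<subseteq> carrier (shift_group F)" using openin_subset[OF A] by simp
  fix p assume p: "p \<in> A"
  obtain x y where xy: "p = (x, y)" by (cases p)
  obtain B C where BC: "x \<in> B" "openin (product_topology (\<lambda>_. discrete_topology (carrier F)) {0..}) C" "y \<in> C" "B \<times> C \<subseteq> A"
    using A[unfolded shift_topology_def openin_prod_topology_alt, rule_format, of x y] p xy by auto
  obtain W where W: "finite {i \<in> {0..}. W i \<noteq> carrier F}" "y \<in> Pi\<^sub>E {0..} W" "Pi\<^sub>E {0..} W \<subseteq> C"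
    using bspec[OF iffD1[OF openin_product_topology_alt BC(2)] BC(3)] by auto
  \<comment> \<open>n exceeds every constrained index of the box. The 0 and the + 1 make n positive,
    so that agreement below n also fixes the component on the negative integers.\<close>
  define n where "n = Max (insert 0 {i \<in> {0..}. W i \<noteq> carrier F}) + 1"
  have M0: "0 \<le> Max (insert 0 {i \<in> {0..}. W i \<noteq> carrier F})" using W(1) by simp
  then have n0: "0 < n" unfolding n_def by linarith
  have Wn: "W i = carrier F" if "n \<le> i" for i
  proof (rule ccontr)
    assume "W i \<noteq> carrier F"
    then have "i \<in> insert 0 {i \<in> {0..}. W i \<noteq> carrier F}" using that n0 by simp
    then have "i \<le> Max (insert 0 {i \<in> {0..}. W i \<noteq> carrier F})" using W(1) by (intro Max_ge) auto
    then show False using that unfolding n_def by simp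
  qed
  have "agree_below n p \<subseteq> A"
  proof
    fix q assume q: "q \<in> agree_below n p"
    have "fst q = x"
    proof (rule PiE_ext)
      show "fst q \<in> {..<0} \<rightarrow>\<^sub>E carrier F" "x \<in> {..<0} \<rightarrow>\<^sub>E carrier F"
        using q p sub xy by (auto simp: carrier_shift_group agree_below_def)
      show "fst q k = x k" if "k \<in> {..<0}" for k
      proof -
        have "two_sided q k = two_sided p k" using q that n0 by (simp add: agree_below_def)
        then show ?thesis using that xy by (simp add: two_sided_def)
      qed
    qed
    moreover have "snd q \<in> Pi\<^sub>E {0..} W"
    proof
      fix k :: int assume k: "k \<in> {0..}"
      show "snd q k \<in> W k"
      proof (cases "k < n")
        case True
        then have "two_sided q k = two_sided p k" using q by (simp add: agree_below_def)
        then have "snd q k = y k" using k xy by (simp add: two_sided_def)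
        then show ?thesis using W(2) k by auto
      next
        case False
        then show ?thesis using Wn q k by (auto simp: agree_below_def carrier_shift_group)
      qed
    next
      fix k :: int assume "k \<notin> {0..}"
      then show "snd q k = undefined" using q by (auto simp: agree_below_def carrier_shift_group PiE_iff extensional_def)
    qed
    ultimately show "q \<in> A" using BC(1,4) W(3) by (cases q) auto
  qed
  then show "\<exists>n. agree_below n p \<subseteq> A" by blast
next
  assume A: "A \<subseteq> carrier (shift_group F) \<and> (\<forall>p\<in>A. \<exists>n. agree_below n p \<subseteq> A)"
  show "openin (shift_topology F) A"
  proof (subst openin_subopen, intro ballI)
    fix p assume p: "p \<in> A"
    obtain n where n: "agree_below n p \<subseteq> A" using A p by blast
    have pc: "p \<in> carrier (shift_group F)" using A p by blast
    define W where "W k = (if k < n then {snd p k} else carrier F)" for k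
    define B where "B = {fst p} \<times> Pi\<^sub>E {0..} W"
    have sub: "W k \<subseteq> carrier F" if "k \<in> {0..}" for k
      using pc that by (auto simp: W_def carrier_shift_group)
    have "finite {k \<in> {0..}. W k \<noteq> carrier F}"
      by (rule finite_subset[of _ "{0..<n}"]) (auto simp: W_def)
    then have "openin (product_topology (\<lambda>_. discrete_topology (carrier F)) {0..}) (Pi\<^sub>E {0..} W)"
      using sub by (simp add: openin_PiE_gen)
    moreover have "fst p \<in> carrier (sum_group {..<0} (\<lambda>_. F))" using pc by (auto simp: shift_group_def)
    ultimately have "openin (shift_topology F) B"
      unfolding shift_topology_def B_def by (simp add: openin_prod_Times_iff)
    moreover have "p \<in> B" using pc by (cases p) (auto simp: B_def W_def carrier_shift_group PiE_iff)
    moreover have "B \<subseteq> A"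
    proof
      fix q assume q: "q \<in> B"
      have "q \<in> carrier (shift_group F)"
        using openin_subset[OF \<open>openin (shift_topology F) B\<close>] q by auto
      moreover have "two_sided q k = two_sided p k" if "k < n" for k
        using q that by (cases q) (auto simp: B_def W_def two_sided_def PiE_iff split: if_splits)
      ultimately show "q \<in> A" using n unfolding agree_below_def by blast
    qed
    ultimately show "\<exists>B. openin (shift_topology F) B \<and> p \<in> B \<and> B \<subseteq> A" by blast
  qed
qed

lemma agree_below_mem: "p \<in> carrier (shift_group F) \<Longrightarrow> p \<in> agree_below n p"
  by (simp add: agree_below_def)

lemma openin_agree_below: "openin (shift_topology F) (agree_below n p)"
  unfolding openin_shift_topology_iff
proof (intro conjI ballI exI)
  fix q assume "q \<in> agree_below n p"
  then show "agree_below n q \<subseteq> agree_below n p" by (simp add: agree_below_def subset_iff)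
qed (simp add: agree_below_def)

lemma Hausdorff_shift_topology: "Hausdorff_space (shift_topology F)"
  by (simp add: shift_topology_def Hausdorff_space_prod_topology Hausdorff_space_product_topology)

lemma locally_compact_shift_topology: "locally_compact_space (shift_topology F)"
proof -
  have "compact_space (product_topology (\<lambda>_. discrete_topology (carrier F)) {0::int..})"
    using finite_carrier by (simp add: compact_space_product_topology compact_space_discrete_topology)
  then show ?thesis
    unfolding shift_topology_def locally_compact_space_prod_topology
    by (simp add: compact_imp_locally_compact_space locally_compact_space_discrete_topology)
qed

text \<open>Prescribing one coordinate gives a clopen set, so every coordinate is constant on a
  connected set.\<close>

lemma totally_disconnected_shift_topology: "totally_disconnected_space (shift_topology F)"
  unfolding totally_disconnected_space_def
proof (intro allI impI)
  fix C assume C: "connectedin (shift_topology F) C"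
  have Csub: "C \<subseteq> carrier (shift_group F)" using connectedin_subset_topspace[OF C] by simp
  have "p = q" if pq: "p \<in> C" "q \<in> C" for p q
  proof (rule shift_group_eqI)
    show "p \<in> carrier (shift_group F)" "q \<in> carrier (shift_group F)" using pq Csub by auto
    fix n
    have op: "openin (shift_topology F) {r \<in> carrier (shift_group F). P (two_sided r n)}" for P
      unfolding openin_shift_topology_iff
    proof (intro conjI ballI)
      fix r assume "r \<in> {r \<in> carrier (shift_group F). P (two_sided r n)}"
      then have "agree_below (n + 1) r \<subseteq> {r \<in> carrier (shift_group F). P (two_sided r n)}"
        unfolding agree_below_def by auto
      then show "\<exists>k. agree_below k r \<subseteq> {r \<in> carrier (shift_group F). P (two_sided r n)}" by blast
    qed auto
    let ?A = "{r \<in> carrier (shift_group F). two_sided r n = two_sided p n}"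
    have "carrier (shift_group F) - ?A = {r \<in> carrier (shift_group F). two_sided r n \<noteq> two_sided p n}" by auto
    then have "closedin (shift_topology F) ?A" using op by (auto simp: closedin_def)
    then have "C \<subseteq> ?A \<or> disjnt C ?A" by (rule connectedin_clopen_cases[OF C _ op])
    moreover have "p \<in> ?A" using pq Csub by auto
    ultimately have "C \<subseteq> ?A" using pq by (meson disjnt_iff)
    then show "two_sided p n = two_sided q n" using pq by auto
  qed
  then show "\<exists>a. C \<subseteq> {a}" by blast
qed

lemma right_shift_mem: "p \<in> carrier (shift_group F) \<Longrightarrow> right_shift p \<in> carrier (shift_group F)"
proof -
  assume p: "p \<in> carrier (shift_group F)"
  obtain m where m: "\<And>n. n < m \<Longrightarrow> two_sided p n = \<one>" by (rule two_sided_bounded_below[OF p]) blast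
  have "right_shift p = of_two_sided (\<lambda>n. two_sided p (n - 1))"
    by (simp add: right_shift_def of_two_sided_def)
  then show ?thesis using two_sided_closed[OF p] m of_two_sided_mem[of "\<lambda>n. two_sided p (n - 1)" "m + 1"] by simp
qed

definition left_shift :: "(int \<Rightarrow> 'a) \<times> (int \<Rightarrow> 'a) \<Rightarrow> (int \<Rightarrow> 'a) \<times> (int \<Rightarrow> 'a)" where
  "left_shift p = of_two_sided (\<lambda>n. two_sided p (n + 1))"

lemma left_shift_mem: "p \<in> carrier (shift_group F) \<Longrightarrow> left_shift p \<in> carrier (shift_group F)"
proof -
  assume p: "p \<in> carrier (shift_group F)"
  obtain m where m: "\<And>n. n < m \<Longrightarrow> two_sided p n = \<one>" by (rule two_sided_bounded_below[OF p]) blast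
  then show ?thesis unfolding left_shift_def using two_sided_closed[OF p]
    by (intro of_two_sided_mem[of _ "m - 1"]) auto
qed

lemma continuous_map_shift_topologyI:
  assumes "\<And>p. p \<in> carrier (shift_group F) \<Longrightarrow> f p \<in> carrier (shift_group F)"
    and "\<And>p n. p \<in> carrier (shift_group F) \<Longrightarrow> \<exists>m. f ` agree_below m p \<subseteq> agree_below n (f p)"
  shows "continuous_map (shift_topology F) (shift_topology F) f"
  unfolding continuous_map_def
proof (intro conjI allI impI)
  show "f \<in> topspace (shift_topology F) \<rightarrow> topspace (shift_topology F)" using assms(1) by simp
  fix A assume A: "openin (shift_topology F) A"
  show "openin (shift_topology F) {p \<in> topspace (shift_topology F). f p \<in> A}"
    unfolding openin_shift_topology_iff
  proof (intro conjI ballI)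
    fix p assume p: "p \<in> {p \<in> topspace (shift_topology F). f p \<in> A}"
    then obtain n where "agree_below n (f p) \<subseteq> A" using A unfolding openin_shift_topology_iff by blast
    moreover have "p \<in> carrier (shift_group F)" using p by simp
    then obtain m where "f ` agree_below m p \<subseteq> agree_below n (f p)" using assms(2) by blast
    ultimately have "agree_below m p \<subseteq> {p \<in> topspace (shift_topology F). f p \<in> A}"
      by (auto simp: agree_below_def)
    then show "\<exists>m. agree_below m p \<subseteq> {p \<in> topspace (shift_topology F). f p \<in> A}" by blast
  qed auto
qed

lemma homeomorphic_right_shift: "homeomorphic_map (shift_topology F) (shift_topology F) right_shift"
proof -
  have "continuous_map (shift_topology F) (shift_topology F) right_shift"
  proof (rule continuous_map_shift_topologyI[OF right_shift_mem])
    fix p n assume "p \<in> carrier (shift_group F)"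
    have "right_shift ` agree_below n p \<subseteq> agree_below n (right_shift p)"
      by (auto simp: agree_below_def right_shift_mem)
    then show "\<exists>m. right_shift ` agree_below m p \<subseteq> agree_below n (right_shift p)" by blast
  qed
  moreover have "continuous_map (shift_topology F) (shift_topology F) left_shift"
  proof (rule continuous_map_shift_topologyI[OF left_shift_mem])
    fix p n assume "p \<in> carrier (shift_group F)"
    have "left_shift ` agree_below (n + 1) p \<subseteq> agree_below n (left_shift p)"
      by (auto simp: agree_below_def left_shift_mem) (simp add: left_shift_def)
    then show "\<exists>m. left_shift ` agree_below m p \<subseteq> agree_below n (left_shift p)" by blast
  qed
  moreover have "left_shift (right_shift p) = p" "right_shift (left_shift p) = p"
    if "p \<in> carrier (shift_group F)" for p
    using that by (auto intro!: shift_group_eqI simp: left_shift_mem right_shift_mem) (simp_all add: left_shift_def)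
  ultimately show ?thesis unfolding homeomorphic_map_maps homeomorphic_maps_def by auto
qed

lemma right_shift_iso: "right_shift \<in> iso (shift_group F) (shift_group F)"
proof -
  interpret S: group "shift_group F" by (rule group_shift_group)
  have "bij_betw right_shift (carrier (shift_group F)) (carrier (shift_group F))"
    using homeomorphic_right_shift homeomorphic_eq_everything_map[of "shift_topology F" "shift_topology F" right_shift]
    by (simp add: bij_betw_def)
  moreover have "right_shift (p \<otimes>\<^bsub>shift_group F\<^esub> q) = right_shift p \<otimes>\<^bsub>shift_group F\<^esub> right_shift q"
    if "p \<in> carrier (shift_group F)" "q \<in> carrier (shift_group F)" for p q
    using that by (intro shift_group_eqI) (auto simp: right_shift_mem)
  ultimately show ?thesis by (simp add: iso_def hom_def right_shift_mem)
qed

lemma shift_contraction_group: "lc_contraction_group (shift_group F) (shift_topology F) right_shift"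
proof -
  interpret S: group "shift_group F" by (rule group_shift_group)
  show ?thesis
  proof unfold_locales
    show "continuous_map (prod_topology (shift_topology F) (shift_topology F)) (shift_topology F)
        (\<lambda>(x, y). x \<otimes>\<^bsub>shift_group F\<^esub> y)"
      unfolding continuous_map_def
    proof (intro conjI allI impI)
      fix A assume A: "openin (shift_topology F) A"
      show "openin (prod_topology (shift_topology F) (shift_topology F))
        {z \<in> topspace (prod_topology (shift_topology F) (shift_topology F)).
          (case z of (x, y) \<Rightarrow> x \<otimes>\<^bsub>shift_group F\<^esub> y) \<in> A}" (is "openin _ ?B")
        unfolding openin_prod_topology_alt
      proof (intro allI impI)
        fix p q assume pq: "(p, q) \<in> ?B"
        then obtain n where n: "agree_below n (p \<otimes>\<^bsub>shift_group F\<^esub> q) \<subseteq> A"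
          using A unfolding openin_shift_topology_iff by auto
        have "agree_below n p \<times> agree_below n q \<subseteq> ?B"
        proof (rule subsetI, elim SigmaE)
          fix z x y assume xy: "z = (x, y)" "x \<in> agree_below n p" "y \<in> agree_below n q"
          then have "x \<otimes>\<^bsub>shift_group F\<^esub> y \<in> agree_below n (p \<otimes>\<^bsub>shift_group F\<^esub> q)"
            by (simp add: agree_below_def)
          then show "z \<in> ?B" using n xy by (auto simp: agree_below_def)
        qed
        then show "\<exists>C D. openin (shift_topology F) C \<and> openin (shift_topology F) D
            \<and> p \<in> C \<and> q \<in> D \<and> C \<times> D \<subseteq> ?B"
          using openin_agree_below agree_below_mem pq
          by (intro exI[of _ "agree_below n p"] exI[of _ "agree_below n q"]) auto
      qed
    qed auto
    show "continuous_map (shift_topology F) (shift_topology F) (m_inv (shift_group F))"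
    proof (rule continuous_map_shift_topologyI[OF S.inv_closed])
      fix p n assume "p \<in> carrier (shift_group F)"
      then have "m_inv (shift_group F) ` agree_below n p \<subseteq> agree_below n (inv\<^bsub>shift_group F\<^esub> p)"
        by (auto simp: agree_below_def two_sided_inv)
      then show "\<exists>m. m_inv (shift_group F) ` agree_below m p \<subseteq> agree_below n (inv\<^bsub>shift_group F\<^esub> p)" by blast
    qed
    show "limitin (shift_topology F) (\<lambda>n. (right_shift ^^ n) p) \<one>\<^bsub>shift_group F\<^esub> sequentially"
      if p: "p \<in> carrier (shift_group F)" for p
      unfolding limitin_def
    proof (intro conjI allI impI)
      fix A assume A: "openin (shift_topology F) A \<and> \<one>\<^bsub>shift_group F\<^esub> \<in> A"
      then obtain n where n: "agree_below n \<one>\<^bsub>shift_group F\<^esub> \<subseteq> A" unfolding openin_shift_topology_iff by blast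
      obtain m where m: "\<And>k. k < m \<Longrightarrow> two_sided p k = \<one>" by (rule two_sided_bounded_below[OF p]) blast
      have mem: "(right_shift ^^ k) p \<in> carrier (shift_group F)" for k
        using p by (induction k) (auto simp: right_shift_mem)
      have "(right_shift ^^ k) p \<in> A" if "nat (n - m) \<le> k" for k
      proof -
        have "(right_shift ^^ k) p \<in> agree_below n \<one>\<^bsub>shift_group F\<^esub>"
          using mem that m by (auto simp: agree_below_def two_sided_right_shift_iter)
        then show ?thesis using n by blast
      qed
      then show "\<forall>\<^sub>F k in sequentially. (right_shift ^^ k) p \<in> A" unfolding eventually_sequentially by blast
    qed simp
  qed (auto simp: Hausdorff_shift_topology locally_compact_shift_topology right_shift_iso homeomorphic_right_shift)
qed

end

section \<open>Isomorphism with a shift\<close>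

text \<open>The product of cyclic groups lives on a type built from that of G, whereas the existence
  claim fixes the type of F as \<open>nat\<close>; the structure is transported along an
  injection.\<close>

lemma (in comm_group) finite_nat_copy:
  assumes "finite (carrier G)"
  obtains F :: "nat monoid" and h where "comm_group F" "finite (carrier F)" "h \<in> iso F G"
proof -
  obtain b :: "'a \<Rightarrow> nat" where b: "inj_on b (carrier G)" using finite_imp_inj_to_nat_seg[OF assms] by blast
  let ?i = "inv_into (carrier G) b"
  define F where "F = \<lparr>carrier = b ` carrier G, mult = (\<lambda>x y. b (?i x \<otimes> ?i y)), one = b \<one>\<rparr>"
  have iso: "b \<in> iso G F" using b by (auto simp: iso_def hom_def F_def bij_betw_def)
  then have "comm_group (F\<lparr>one := b \<one>\<rparr>)" by (rule iso_imp_img_comm_group)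
  then have "comm_group F" by (simp add: F_def)
  then show thesis using that[of F, OF _ _ iso_set_sym[OF iso]] assms by (simp add: F_def)
qed

lemma topological_group_hom_continuous:
  assumes G: "topological_group G T" and H: "topological_group H S" and f: "f \<in> hom G H"
    and nbhd: "\<And>A. openin S A \<Longrightarrow> \<one>\<^bsub>H\<^esub> \<in> A \<Longrightarrow> \<exists>B. openin T B \<and> \<one>\<^bsub>G\<^esub> \<in> B \<and> f ` B \<subseteq> A"
  shows "continuous_map T S f"
proof -
  interpret G: topological_group G T by fact
  interpret H: topological_group H S by fact
  interpret hom: group_hom G H f by unfold_locales (rule f)
  show ?thesis
    unfolding continuous_map_def
  proof (intro conjI allI impI)
    show "f \<in> topspace T \<rightarrow> topspace S" by (auto simp: G.topspace_eq H.topspace_eq)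
    fix A assume A: "openin S A"
    show "openin T {x \<in> topspace T. f x \<in> A}"
    proof (subst openin_subopen, intro ballI)
      fix x assume "x \<in> {x \<in> topspace T. f x \<in> A}"
      then have x: "x \<in> carrier G" "f x \<in> A" by (auto simp: G.topspace_eq)
      obtain B where B: "openin T B" "\<one>\<^bsub>G\<^esub> \<in> B" "f ` B \<subseteq> {y \<in> carrier H. f x \<otimes>\<^bsub>H\<^esub> y \<in> A}"
        using nbhd[OF H.openin_translation_vimage[OF _ A, of "f x"]] x by auto
      let ?C = "{y \<in> carrier G. inv\<^bsub>G\<^esub> x \<otimes>\<^bsub>G\<^esub> y \<in> B}"
      have "openin T ?C" using B(1) x by (intro G.openin_translation_vimage) auto
      moreover have "x \<in> ?C" using x B(2) by simp
      moreover have "?C \<subseteq> {x \<in> topspace T. f x \<in> A}"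
      proof
        fix y assume y: "y \<in> ?C"
        then have "f x \<otimes>\<^bsub>H\<^esub> f (inv\<^bsub>G\<^esub> x \<otimes>\<^bsub>G\<^esub> y) \<in> A" using B(3) by blast
        also have "f x \<otimes>\<^bsub>H\<^esub> f (inv\<^bsub>G\<^esub> x \<otimes>\<^bsub>G\<^esub> y) = f y"
          using x y by (simp add: H.m_assoc[symmetric])
        finally show "y \<in> {x \<in> topspace T. f x \<in> A}" using y by (simp add: G.topspace_eq)
      qed
      ultimately show "\<exists>C. openin T C \<and> x \<in> C \<and> C \<subseteq> {x \<in> topspace T. f x \<in> A}" by blast
    qed
  qed
qed

text \<open>\<open>X\<close> is here the set of generators from the cyclic decomposition, not the
  variable of the series. \<open>h\<close> identifies \<open>F\<close> with the product of the
  cyclic groups whose orders are those of the generators modulo \<open>N\<close>.\<close>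

locale lattice_basis = presented_lattice +
  fixes X :: "('a \<Rightarrow> int fls) set" and F :: "nat monoid" and h :: "nat \<Rightarrow> ('a \<Rightarrow> int fls) \<Rightarrow> int"
  assumes X_finite: "finite X" and X_span: "fls_module.span (X \<union> N) = UNIV"
    and X_relation: "(\<Sum>x\<in>X. fls_scale (c x) x) \<in> N \<longleftrightarrow> (\<forall>x\<in>X. of_nat (quotient.quot_ord x) dvd c x)"
    and F_comm_group: "comm_group F" and F_finite: "finite (carrier F)"
    and h_iso: "h \<in> iso F (product_group X (\<lambda>x. integer_mod_group (quotient.quot_ord x)))"
begin

interpretation F: finite_comm_group F
  using F_comm_group F_finite by (simp add: finite_comm_group_def finite_comm_group_axioms_def)

abbreviation "qord \<equiv> quotient.quot_ord"

abbreviation "cyclic_product \<equiv> product_group X (\<lambda>x. integer_mod_group (qord x))"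

definition comb :: "(('a \<Rightarrow> int fls) \<Rightarrow> int fls) \<Rightarrow> 'a \<Rightarrow> int fls" where
  "comb c = (\<Sum>x\<in>X. fls_scale (c x) x)"

lemma comb_cong: "(\<And>x. x \<in> X \<Longrightarrow> c x = d x) \<Longrightarrow> comb c = comb d"
  unfolding comb_def by (intro sum.cong) auto

lemma comb_add: "comb (\<lambda>x. c x + d x) = comb c + comb d"
  unfolding comb_def by (simp add: fls_module.scale_left_distrib sum.distrib)

lemma comb_diff: "comb (\<lambda>x. c x - d x) = comb c - comb d"
  unfolding comb_def by (simp add: fls_module.scale_left_diff_distrib sum_subtractf)

lemma comb_scale: "comb (\<lambda>x. a * c x) = fls_scale a (comb c)"
  unfolding comb_def by (simp add: fls_module.scale_sum_right)

lemma \<Phi>_eq_iff: "\<Phi> v = \<Phi> w \<longleftrightarrow> v - w \<in> N"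
proof -
  have "\<Phi> v \<otimes> inv (\<Phi> w) = \<one> \<longleftrightarrow> \<Phi> v = \<Phi> w"
    by (metis \<Phi>_closed inv_closed inv_inv inv_equality r_inv)
  then show ?thesis by (simp add: N_def \<Phi>_diff)
qed

text \<open>By \<open>X_relation\<close> the generators satisfy no relations beyond their orders, so
  coefficients reduced modulo these orders are a normal form.\<close>

lemma \<Phi>_comb_eq_iff:
  "\<Phi> (comb c) = \<Phi> (comb d) \<longleftrightarrow> (\<forall>x\<in>X. \<forall>k. c x $$ k mod int (qord x) = d x $$ k mod int (qord x))"
proof -
  have "\<Phi> (comb c) = \<Phi> (comb d) \<longleftrightarrow> comb (\<lambda>x. c x - d x) \<in> N"
    unfolding \<Phi>_eq_iff comb_diff ..
  also have "\<dots> \<longleftrightarrow> (\<forall>x\<in>X. of_nat (qord x) dvd c x - d x)"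
    unfolding comb_def by (rule X_relation)
  finally show ?thesis by (simp add: of_nat_dvd_int_fls_iff mod_eq_dvd_iff)
qed

lemma \<Phi>_comb_onto: obtains c where "\<Phi> v = \<Phi> (comb c)"
proof -
  have "v \<in> fls_module.span (X \<union> N)" using X_span by simp
  then obtain a b where ab: "v = a + b" "a \<in> fls_module.span X" "b \<in> fls_module.span N"
    unfolding fls_module.span_Un by auto
  have "b \<in> N" using ab(3) N_subspace fls_module.span_eq_iff by blast
  moreover obtain c where "a = comb c"
    using ab(2) unfolding fls_module.span_finite[OF X_finite] comb_def by auto
  ultimately show thesis using that[of c] ab(1) by (simp add: N_def \<Phi>_add)
qed

lemma h_closed: "a \<in> carrier F \<Longrightarrow> x \<in> X \<Longrightarrow> h a x \<in> {0..<int (qord x)}"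
proof -
  assume "a \<in> carrier F" "x \<in> X"
  then have "h a \<in> carrier cyclic_product" using h_iso unfolding iso_def hom_def by blast
  then have "h a x \<in> carrier (integer_mod_group (qord x))" using \<open>x \<in> X\<close> by auto
  then show ?thesis using quotient.quot_ord_pos[of x] by (simp add: carrier_integer_mod_group)
qed

lemma h_one: "x \<in> X \<Longrightarrow> h \<one>\<^bsub>F\<^esub> x = 0"
proof -
  have "h \<one>\<^bsub>F\<^esub> = \<one>\<^bsub>cyclic_product\<^esub>"
    using h_iso F_comm_group by (intro hom_one[of h F]) (auto simp: iso_def comm_group_def)
  then show "x \<in> X \<Longrightarrow> h \<one>\<^bsub>F\<^esub> x = 0" by simp
qed

lemma h_mult: "\<lbrakk>a \<in> carrier F; b \<in> carrier F; x \<in> X\<rbrakk> \<Longrightarrow> h (a \<otimes>\<^bsub>F\<^esub> b) x = (h a x + h b x) mod int (qord x)"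
  using h_iso unfolding iso_def hom_def by auto

lemma h_eqI:
  assumes "a \<in> carrier F" "b \<in> carrier F" "\<And>x. x \<in> X \<Longrightarrow> h a x = h b x"
  shows "a = b"
proof -
  have "h a \<in> carrier cyclic_product" "h b \<in> carrier cyclic_product"
    using assms(1,2) h_iso unfolding iso_def hom_def by blast+
  then have "h a = h b" using assms(3) by (intro PiE_ext[of "h a" X]) auto
  then show ?thesis using h_iso assms(1,2) unfolding iso_def bij_betw_def inj_on_def by blast
qed

lemma h_onto:
  assumes "\<And>x. x \<in> X \<Longrightarrow> f x \<in> {0..<int (qord x)}"
  obtains a where "a \<in> carrier F" "\<And>x. x \<in> X \<Longrightarrow> h a x = f x"
proof -
  have "restrict f X \<in> carrier cyclic_product"
    using assms quotient.quot_ord_pos by (auto simp: carrier_integer_mod_group)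
  moreover have "h ` carrier F = carrier cyclic_product" using h_iso by (simp add: iso_def bij_betw_def)
  ultimately obtain a where "a \<in> carrier F" "restrict f X = h a" by blast
  then show thesis using that[of a] by (metis restrict_apply')
qed

text \<open>The k-th entry of the sequence, an element of \<open>F\<close>, supplies the k-th
  coefficient at every generator. Triviality far to the left is the Laurent condition.\<close>

definition digits :: "(int \<Rightarrow> nat) \<times> (int \<Rightarrow> nat) \<Rightarrow> ('a \<Rightarrow> int fls) \<Rightarrow> int fls" where
  "digits p x = Abs_fls (\<lambda>k. h (two_sided p k) x)"

lemma digits_nth:
  assumes "p \<in> carrier (shift_group F)" "x \<in> X"
  shows "digits p x $$ k = h (two_sided p k) x"
proof -
  obtain m where "\<And>n. n < m \<Longrightarrow> two_sided p n = \<one>\<^bsub>F\<^esub>" by (rule F.two_sided_bounded_below[OF assms(1)]) blast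
  then show ?thesis unfolding digits_def using h_one[OF assms(2)]
    by (intro nth_Abs_fls_lower_bound[of m]) auto
qed

definition \<Psi> :: "(int \<Rightarrow> nat) \<times> (int \<Rightarrow> nat) \<Rightarrow> 'a" where
  "\<Psi> p = \<Phi> (comb (digits p))"

text \<open>\<open>digits\<close> is additive only modulo the orders of the generators, a difference
  that \<Phi> does not see.\<close>

lemma \<Psi>_mult:
  assumes p: "p \<in> carrier (shift_group F)" and q: "q \<in> carrier (shift_group F)"
  shows "\<Psi> (p \<otimes>\<^bsub>shift_group F\<^esub> q) = \<Psi> p \<otimes> \<Psi> q"
proof -
  interpret S: group "shift_group F" by (rule F.group_shift_group)
  have "\<Phi> (comb (digits (p \<otimes>\<^bsub>shift_group F\<^esub> q))) = \<Phi> (comb (\<lambda>x. digits p x + digits q x))"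
    unfolding \<Phi>_comb_eq_iff using p q by (simp add: digits_nth h_mult F.two_sided_closed)
  then show ?thesis by (simp add: \<Psi>_def comb_add \<Phi>_add)
qed

lemma \<Psi>_inj: "inj_on \<Psi> (carrier (shift_group F))"
proof (rule inj_onI)
  fix p q assume pq: "p \<in> carrier (shift_group F)" "q \<in> carrier (shift_group F)" "\<Psi> p = \<Psi> q"
  have "two_sided p k = two_sided q k" for k
  proof (rule h_eqI)
    show c: "two_sided p k \<in> carrier F" "two_sided q k \<in> carrier F" using pq F.two_sided_closed by auto
    fix x assume x: "x \<in> X"
    then have "digits p x $$ k mod int (qord x) = digits q x $$ k mod int (qord x)"
      using pq(3) unfolding \<Psi>_def \<Phi>_comb_eq_iff by blast
    then show "h (two_sided p k) x = h (two_sided q k) x"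
      using h_closed[OF c(1) x] h_closed[OF c(2) x] pq x by (simp add: digits_nth)
  qed
  then show "p = q" using pq by (intro F.shift_group_eqI)
qed

text \<open>Coefficients are reduced modulo the orders one index at a time. A zero coefficient at
  every generator gives the identity of \<open>F\<close>, so the lower bound n is kept.\<close>

lemma \<Psi>_of_comb:
  assumes "\<And>x k. x \<in> X \<Longrightarrow> k < n \<Longrightarrow> c x $$ k = 0"
  obtains p where "p \<in> carrier (shift_group F)" "\<And>k. k < n \<Longrightarrow> two_sided p k = \<one>\<^bsub>F\<^esub>" "\<Psi> p = \<Phi> (comb c)"
proof -
  have "\<exists>a\<in>carrier F. \<forall>x\<in>X. h a x = c x $$ k mod int (qord x)" for k
    using h_onto[of "\<lambda>x. c x $$ k mod int (qord x)"] quotient.quot_ord_pos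
    by (metis (no_types, lifting) atLeastLessThan_iff of_nat_0_less_iff pos_mod_bound pos_mod_sign)
  then obtain f where f: "\<And>k. f k \<in> carrier F" "\<And>k x. x \<in> X \<Longrightarrow> h (f k) x = c x $$ k mod int (qord x)" by metis
  have f1: "f k = \<one>\<^bsub>F\<^esub>" if "k < n" for k
    using that f assms h_one by (intro h_eqI) auto
  let ?p = "of_two_sided f"
  have p: "?p \<in> carrier (shift_group F)" by (rule F.of_two_sided_mem[OF f(1) f1])
  have "\<Psi> ?p = \<Phi> (comb c)"
    unfolding \<Psi>_def \<Phi>_comb_eq_iff by (simp add: digits_nth[OF p] f(2))
  then show thesis using that[of ?p] p f1 by simp
qed

lemma \<Psi>_equivariant:
  assumes p: "p \<in> carrier (shift_group F)"
  shows "\<Psi> (right_shift p) = \<alpha> (\<Psi> p)"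
proof -
  have "digits (right_shift p) x = fls_X * digits p x" if "x \<in> X" for x
    using that p by (intro fls_eqI) (simp add: digits_nth F.right_shift_mem fls_X_times_conv_shift)
  then have "comb (digits (right_shift p)) = fls_scale fls_X (comb (digits p))"
    unfolding comb_scale[symmetric] by (rule comb_cong)
  then show ?thesis by (simp only: \<Psi>_def \<Phi>_shift)
qed

text \<open>m is a common lower bound for where the finitely many generators start. It gives
  continuity of \<Psi> at the identity with a loss independent of n.\<close>

lemma \<Psi>_small: obtains m where "\<And>n. \<Psi> ` F.agree_below n \<one>\<^bsub>shift_group F\<^esub> \<subseteq> level (n + m)"
proof -
  have "\<forall>x. \<exists>m. vanishes_below m x" using vanishes_below_exists by blast
  then obtain f where f: "\<And>x. vanishes_below (f x) x" by metis
  define m where "m = Min (insert 0 (f ` X))"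
  have m: "x r $$ k = 0" if "x \<in> X" "r \<in> R" "k < m" for x r k
  proof -
    have "m \<le> f x" unfolding m_def using that X_finite by simp
    then show ?thesis using f[of x] that unfolding vanishes_below_def by simp
  qed
  have "\<Psi> p \<in> level (n + m)" if p: "p \<in> F.agree_below n \<one>\<^bsub>shift_group F\<^esub>" for n p
  proof -
    have pc: "p \<in> carrier (shift_group F)" using p unfolding F.agree_below_def by blast
    have d: "digits p x $$ k = 0" if "x \<in> X" "k < n" for x k
      using p that h_one by (simp add: digits_nth[OF pc] F.agree_below_def)
    have "vanishes_below (n + m) (comb (digits p))"
      unfolding vanishes_below_def
    proof (intro ballI allI impI)
      fix r k assume "r \<in> R" "k < n + m"
      then have "(digits p x * x r) $$ k = 0" if "x \<in> X" for x
        using that m d by (intro fls_mult_vanishes_below[of n _ m]) auto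
      then show "comb (digits p) r $$ k = 0" by (simp add: comb_def sum_fun_apply fls_nth_sum)
    qed
    then show ?thesis unfolding \<Psi>_def by (rule \<Phi>_level)
  qed
  then show thesis using that by blast
qed

text \<open>Openness of \<Psi>, and surjectivity as well. Each unit vector is rewritten through the
  generators once and for all; l bounds the start of these finitely many coefficients, and
  substituting them into an expansion over \<open>R\<close> costs only l.\<close>

lemma \<Psi>_onto_level:
  obtains l where "\<And>n. level n \<subseteq> \<Psi> ` F.agree_below (n + l) \<one>\<^bsub>shift_group F\<^esub>"
proof -
  have "\<forall>r. \<exists>c. \<Phi> (unit_vec r) = \<Phi> (comb c)" by (metis \<Phi>_comb_onto)
  then obtain c where c: "\<And>r. \<Phi> (unit_vec r) = \<Phi> (comb (c r))" by metis
  have "\<forall>r x. \<exists>m. \<forall>k<m. c r x $$ k = 0" by (metis fls_nth_vanishes_belowE)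
  then obtain f where f: "\<And>r x k. k < f r x \<Longrightarrow> c r x $$ k = 0" by metis
  define l where "l = Min (insert 0 ((\<lambda>(r, x). f r x) ` (R \<times> X)))"
  have l: "c r x $$ k = 0" if "r \<in> R" "x \<in> X" "k < l" for r x k
  proof -
    have "l \<le> f r x" unfolding l_def using that X_finite R_finite by (intro Min_le) auto
    then show ?thesis using f that by simp
  qed
  have "g \<in> \<Psi> ` F.agree_below (n + l) \<one>\<^bsub>shift_group F\<^esub>" if "g \<in> level n" for g n
  proof -
    obtain v where v: "vanishes_below n v" "\<Phi> v = g" using \<Phi>_onto_level[OF \<open>g \<in> level n\<close>] .
    define d where "d x = (\<Sum>r\<in>R. v r * c r x)" for x
    have "comb d = (\<Sum>r\<in>R. fls_scale (v r) (comb (c r)))"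
    proof -
      have "comb d = (\<Sum>x\<in>X. \<Sum>r\<in>R. fls_scale (v r * c r x) x)"
        unfolding comb_def d_def by (simp add: fls_module.scale_sum_left)
      also have "\<dots> = (\<Sum>r\<in>R. \<Sum>x\<in>X. fls_scale (v r * c r x) x)" by (rule sum.swap)
      finally show ?thesis by (simp add: comb_scale[symmetric]) (simp add: comb_def)
    qed
    then have "(\<Sum>r\<in>R. fls_scale (v r) (unit_vec r)) - comb d = (\<Sum>r\<in>R. fls_scale (v r) (unit_vec r - comb (c r)))"
      by (simp add: sum_subtractf fls_module.scale_right_diff_distrib)
    also have "\<dots> \<in> N"
      using c \<Phi>_eq_iff by (intro fls_module.subspace_sum[OF N_subspace] fls_module.subspace_scale[OF N_subspace]) auto
    finally have "v - comb d \<in> N"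
      using fls_module.subspace_add[OF N_subspace minus_unit_combination_in_N[of v]] by fastforce
    then have gd: "g = \<Phi> (comb d)" using v(2) \<Phi>_eq_iff by blast
    have d0: "d x $$ k = 0" if "x \<in> X" "k < n + l" for x k
    proof -
      have "(v r * c r x) $$ k = 0" if "r \<in> R" for r
        using that \<open>x \<in> X\<close> \<open>k < n + l\<close> v(1) l
        by (intro fls_mult_vanishes_below[of n _ l]) (auto simp: vanishes_below_def)
      then show ?thesis by (simp add: d_def fls_nth_sum)
    qed
    obtain p where "p \<in> carrier (shift_group F)" "\<And>k. k < n + l \<Longrightarrow> two_sided p k = \<one>\<^bsub>F\<^esub>" "\<Psi> p = \<Phi> (comb d)"
      by (rule \<Psi>_of_comb[OF d0]) blast+
    then show ?thesis using gd by (intro image_eqI[of _ _ p]) (auto simp: F.agree_below_def)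
  qed
  then show thesis using that by blast
qed

lemma \<Psi>_iso: "\<Psi> \<in> iso (shift_group F) G"
proof -
  have "g \<in> \<Psi> ` carrier (shift_group F)" if g: "g \<in> carrier G" for g
  proof -
    obtain n where "g \<in> level n" using level_absorbing[OF g] .
    moreover obtain l where "\<And>n. level n \<subseteq> \<Psi> ` F.agree_below (n + l) \<one>\<^bsub>shift_group F\<^esub>" by (rule \<Psi>_onto_level) blast
    ultimately show ?thesis unfolding F.agree_below_def by blast
  qed
  moreover have mem: "\<Psi> p \<in> carrier G" for p by (simp add: \<Psi>_def)
  ultimately have "bij_betw \<Psi> (carrier (shift_group F)) (carrier G)"
    using \<Psi>_inj unfolding bij_betw_def by blast
  then show ?thesis by (simp add: iso_def hom_def \<Psi>_mult mem)
qed

theorem isomorphic_to_shift: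
  "isomorphic_contraction_groups G T \<alpha> (shift_group F) (shift_topology F) right_shift"
proof -
  interpret S: lc_contraction_group "shift_group F" "shift_topology F" right_shift
    by (rule F.shift_contraction_group)
  let ?\<phi> = "inv_into (carrier (shift_group F)) \<Psi>"
  have iso: "?\<phi> \<in> iso G (shift_group F)" by (rule S.iso_set_sym[OF \<Psi>_iso])
  have bij: "bij_betw \<Psi> (carrier (shift_group F)) (carrier G)" using \<Psi>_iso by (simp add: iso_def)
  have \<phi>\<Psi>: "?\<phi> (\<Psi> p) = p" if "p \<in> carrier (shift_group F)" for p using that \<Psi>_inj by simp
  have \<Psi>\<phi>: "\<Psi> (?\<phi> g) = g" "?\<phi> g \<in> carrier (shift_group F)" if "g \<in> carrier G" for g
    using that bij by (auto simp: bij_betw_def f_inv_into_f inv_into_into)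
  obtain m where m: "\<And>n. \<Psi> ` F.agree_below n \<one>\<^bsub>shift_group F\<^esub> \<subseteq> level (n + m)" by (rule \<Psi>_small) blast
  obtain l where l: "\<And>n. level n \<subseteq> \<Psi> ` F.agree_below (n + l) \<one>\<^bsub>shift_group F\<^esub>" by (rule \<Psi>_onto_level) blast
  have "continuous_map (shift_topology F) T \<Psi>"
  proof (rule topological_group_hom_continuous[OF S.topological_group_axioms topological_group_axioms])
    show "\<Psi> \<in> hom (shift_group F) G" using \<Psi>_iso by (simp add: iso_def)
    fix A assume "openin T A" "\<one> \<in> A"
    then obtain n where "level n \<subseteq> A" by (rule level_small)
    then have "\<Psi> ` F.agree_below (n - m) \<one>\<^bsub>shift_group F\<^esub> \<subseteq> A" using m[of "n - m"] by simp
    then show "\<exists>B. openin (shift_topology F) B \<and> \<one>\<^bsub>shift_group F\<^esub> \<in> B \<and> \<Psi> ` B \<subseteq> A"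
      by (intro exI[of _ "F.agree_below (n - m) \<one>\<^bsub>shift_group F\<^esub>"] conjI F.openin_agree_below
          F.agree_below_mem[OF S.one_closed])
  qed
  moreover have "continuous_map T (shift_topology F) ?\<phi>"
  proof (rule topological_group_hom_continuous[OF topological_group_axioms S.topological_group_axioms])
    show "?\<phi> \<in> hom G (shift_group F)" using iso by (simp add: iso_def)
    fix A assume A: "openin (shift_topology F) A" "\<one>\<^bsub>shift_group F\<^esub> \<in> A"
    then obtain n where n: "F.agree_below n \<one>\<^bsub>shift_group F\<^esub> \<subseteq> A" unfolding F.openin_shift_topology_iff by blast
    have "?\<phi> ` level (n - l) \<subseteq> A"
    proof
      fix q assume "q \<in> ?\<phi> ` level (n - l)"
      then obtain p where p: "p \<in> F.agree_below n \<one>\<^bsub>shift_group F\<^esub>" "q = ?\<phi> (\<Psi> p)" using l[of "n - l"] by auto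
      then have "q = p" using \<phi>\<Psi> by (simp add: F.agree_below_def)
      then show "q \<in> A" using p n by blast
    qed
    then show "\<exists>B. openin T B \<and> \<one> \<in> B \<and> ?\<phi> ` B \<subseteq> A"
      by (intro exI[of _ "level (n - l)"] conjI level_open subgroup.one_closed[OF level_subgroup])
  qed
  ultimately have "homeomorphic_maps T (shift_topology F) ?\<phi> \<Psi>"
    using \<phi>\<Psi> \<Psi>\<phi> by (simp add: homeomorphic_maps_def topspace_eq)
  then have "homeomorphic_map T (shift_topology F) ?\<phi>" using homeomorphic_maps_map by blast
  moreover have "right_shift (?\<phi> g) = ?\<phi> (\<alpha> g)" if g: "g \<in> carrier G" for g
    using \<phi>\<Psi>[OF F.right_shift_mem[OF \<Psi>\<phi>(2)[OF g]]] \<Psi>\<phi>[OF g] by (simp add: \<Psi>_equivariant)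
  ultimately show ?thesis unfolding isomorphic_contraction_groups_def using iso by blast
qed

end

section \<open>Existence of the finite abelian group\<close>

lemma comm_group_product_group:
  assumes "\<And>i. i \<in> I \<Longrightarrow> comm_group (G i)"
  shows "comm_group (product_group I G)"
proof -
  have "group (product_group I G)" using assms by (simp add: comm_group_def)
  then interpret group "product_group I G" .
  show ?thesis
  proof (rule group_comm_groupI)
    fix x y assume "x \<in> carrier (product_group I G)" "y \<in> carrier (product_group I G)"
    then show "x \<otimes>\<^bsub>product_group I G\<^esub> y = y \<otimes>\<^bsub>product_group I G\<^esub> x"
      using comm_groupE(4)[OF assms] by (auto simp: PiE_iff fun_eq_iff)
  qed
qed

theorem (in lc_contraction_group) shift_isomorphism_exists:
  assumes td: "totally_disconnected_space T" and torsion: "torsion_group G" and comm: "comm_group G"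
  shows "\<exists>F :: nat monoid. comm_group F \<and> finite (carrier F) \<and>
    isomorphic_contraction_groups G T \<alpha> (shift_group F) (shift_topology F) right_shift"
proof -
  interpret comm_group G by (rule comm)
  obtain U where U: "subgroup U G" "openin T U" "compactin T U" "\<alpha> ` U \<subseteq> U"
    by (rule invariant_compact_open_subgroup[OF td])
  interpret contraction_lattice G T \<alpha> U
  proof (intro contraction_lattice.intro contraction_lattice_axioms.intro)
    show "\<exists>n. (\<alpha> ^^ n) ` U \<subseteq> A" if "openin T A" "\<one> \<in> A" for A
      using iter_of_compact_small[OF td U(3) that] by blast
  qed (fact U lc_contraction_group_axioms comm)+
  have UG: "U \<subseteq> carrier G" using subgroup.subset[OF U(1)] .
  \<comment> \<open>\<open>C r\<close> is the coset of r modulo \<alpha> U. These cosets are open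
    and U is compact, so finitely many of them suffice and their representatives form the digit set
    \<open>R\<close>.\<close>
  define C where "C r = {y \<in> carrier G. inv r \<otimes> y \<in> \<alpha> ` U}" for r
  have \<alpha>U: "openin T (\<alpha> ` U)"
    using homeomorphic_imp_open_map[OF bicontinuous] U(2) unfolding open_map_def by blast
  have op: "openin T B" if "B \<in> C ` U" for B
    using that \<alpha>U UG unfolding C_def by (auto intro!: openin_translation_vimage)
  have "\<one> \<in> \<alpha> ` U"
    using group_hom.hom_one[OF iter_hom[of 1]] subgroup.one_closed[OF U(1)] by force
  then have "r \<in> C r" if "r \<in> U" for r using that UG by (auto simp: C_def)
  then have "U \<subseteq> \<Union>(C ` U)" by blast
  then have "\<exists>\<F>. finite \<F> \<and> \<F> \<subseteq> C ` U \<and> U \<subseteq> \<Union>\<F>" 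
    using op by (intro compactinD[OF U(3)]) auto
  then obtain \<F> where F: "finite \<F>" "\<F> \<subseteq> C ` U" "U \<subseteq> \<Union>\<F>" by (elim exE conjE)
  obtain R where R: "R \<subseteq> U" "finite R" "\<F> = C ` R" using finite_subset_image[OF F(1,2)] by (elim exE conjE)
  obtain e :: nat where e: "0 < e" "\<And>x. x \<in> carrier G \<Longrightarrow> x [^] e = \<one>"
    by (rule finite_exponent[OF comm torsion]) blast
  interpret presented_lattice G T \<alpha> U R e
  proof unfold_locales
    fix u assume u: "u \<in> U"
    then obtain r w where rw: "r \<in> R" "w \<in> U" "inv r \<otimes> u = \<alpha> w" using F(3) R(3) by (auto simp: C_def)
    then have "r \<in> carrier G" "u \<in> carrier G" using R(1) UG u by auto
    then have "u = r \<otimes> (inv r \<otimes> u)" by (simp add: m_assoc[symmetric])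
    then show "\<exists>r\<in>R. \<exists>w\<in>U. u = r \<otimes> \<alpha> w" using rw by metis
  qed (use R e in auto)
  obtain X where X: "finite X" "fls_module.span (X \<union> N) = UNIV"
    "\<And>c. (\<Sum>x\<in>X. fls_scale (c x) x) \<in> N \<longleftrightarrow> (\<forall>x\<in>X. of_nat (quotient.quot_ord x) dvd c x)"
    using quotient.cyclic_decomposition[of "unit_vec ` R"] R(2) span_unit_vec_N by blast
  let ?P = "product_group X (\<lambda>x. integer_mod_group (quotient.quot_ord x))"
  have "comm_group ?P" by (intro comm_group_product_group) simp
  moreover have "finite (carrier ?P)"
    using X(1) quotient.quot_ord_pos by (auto intro!: finite_PiE simp: carrier_integer_mod_group)
  ultimately obtain F :: "nat monoid" and h where Fh: "comm_group F" "finite (carrier F)" "h \<in> iso F ?P"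
    by (rule comm_group.finite_nat_copy)
  interpret lattice_basis G T \<alpha> U R e X F h
    by (intro lattice_basis.intro lattice_basis_axioms.intro presented_lattice_axioms X Fh)
  show ?thesis using Fh isomorphic_to_shift by blast
qed

section \<open>Symmetry and transitivity of isomorphism\<close>

lemma isomorphic_contraction_groups_sym:
  assumes G: "group G" "topspace T = carrier G" "\<And>x. x \<in> carrier G \<Longrightarrow> \<alpha> x \<in> carrier G"
    and iso: "isomorphic_contraction_groups G T \<alpha> H S \<beta>"
  shows "isomorphic_contraction_groups H S \<beta> G T \<alpha>"
proof -
  obtain \<phi> where \<phi>: "\<phi> \<in> iso G H" "homeomorphic_map T S \<phi>" "\<And>x. x \<in> carrier G \<Longrightarrow> \<beta> (\<phi> x) = \<phi> (\<alpha> x)"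
    using iso unfolding isomorphic_contraction_groups_def by blast
  let ?\<psi> = "inv_into (carrier G) \<phi>"
  have inj: "inj_on \<phi> (carrier G)" and im: "\<phi> ` carrier G = carrier H"
    using \<phi>(1) by (auto simp: iso_def bij_betw_def)
  obtain g where g: "homeomorphic_maps T S \<phi> g" using \<phi>(2) homeomorphic_map_maps by blast
  have "?\<psi> y = g y" if "y \<in> topspace S" for y
  proof -
    have "y = \<phi> (g y)" "g y \<in> carrier G"
      using g that unfolding homeomorphic_maps_def continuous_map_def G(2)[symmetric] by auto
    then show ?thesis using inj by (metis inv_into_f_f)
  qed
  moreover have "homeomorphic_map S T g" using g homeomorphic_maps_map by blast
  ultimately have "homeomorphic_map S T ?\<psi>" by (metis (no_types, lifting) homeomorphic_map_eq)
  moreover have "\<alpha> (?\<psi> y) = ?\<psi> (\<beta> y)" if y: "y \<in> carrier H" for y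
  proof -
    obtain x where "x \<in> carrier G" "y = \<phi> x" using y im by blast
    then show ?thesis using \<phi>(3) G(3) inj by simp
  qed
  ultimately show ?thesis
    unfolding isomorphic_contraction_groups_def
    by (intro exI[of _ ?\<psi>] conjI ballI group.iso_set_sym[OF G(1) \<phi>(1)])
qed

lemma isomorphic_contraction_groups_trans:
  assumes "isomorphic_contraction_groups G T \<alpha> H S \<beta>" "isomorphic_contraction_groups H S \<beta> K R \<gamma>"
  shows "isomorphic_contraction_groups G T \<alpha> K R \<gamma>"
proof -
  obtain \<phi> where \<phi>: "\<phi> \<in> iso G H" "homeomorphic_map T S \<phi>" "\<And>x. x \<in> carrier G \<Longrightarrow> \<beta> (\<phi> x) = \<phi> (\<alpha> x)"
    using assms(1) unfolding isomorphic_contraction_groups_def by blast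
  obtain \<psi> where \<psi>: "\<psi> \<in> iso H K" "homeomorphic_map S R \<psi>" "\<And>x. x \<in> carrier H \<Longrightarrow> \<gamma> (\<psi> x) = \<psi> (\<beta> x)"
    using assms(2) unfolding isomorphic_contraction_groups_def by blast
  have "\<gamma> ((\<psi> \<circ> \<phi>) x) = (\<psi> \<circ> \<phi>) (\<alpha> x)" if "x \<in> carrier G" for x
  proof -
    have "\<phi> x \<in> carrier H" using \<phi>(1) that by (auto simp: iso_def hom_def)
    then show ?thesis using \<phi>(3) \<psi>(3) that by simp
  qed
  then show ?thesis
    unfolding isomorphic_contraction_groups_def
    using iso_set_trans[OF \<phi>(1) \<psi>(1)] homeomorphic_map_compose[OF \<phi>(2) \<psi>(2)] by blast
qed

section \<open>Uniqueness of the finite group\<close>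

lemma le_of_power_le:
  fixes a b :: nat
  assumes "\<And>n. a ^ n \<le> b ^ (n + k)" "0 < b"
  shows "a \<le> b"
proof (rule ccontr)
  assume "\<not> a \<le> b"
  then have "1 < real a / real b" using assms(2) by simp
  then obtain n where n: "real b ^ k < (real a / real b) ^ n" using real_arch_pow by blast
  then have "real b ^ k * real b ^ n < real a ^ n"
    using assms(2) by (simp add: power_divide field_simps)
  then have "real (b ^ (n + k)) < real (a ^ n)" by (simp add: power_add mult.commute)
  then show False using assms(1)[of n] by linarith
qed

text \<open>A substitute for the homomorphisms on the quotient of \<open>H\<close> by the normal
  closure of \<open>N\<close>. Extensionality makes each of them count once and keeps the set
  finite.\<close>

definition homs_killing :: "('h, 'm) monoid_scheme \<Rightarrow> 'h set \<Rightarrow> ('f, 'n) monoid_scheme \<Rightarrow> ('h \<Rightarrow> 'f) set" where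
  "homs_killing H N F = {f \<in> carrier H \<rightarrow>\<^sub>E carrier F. f \<in> hom H F \<and> (\<forall>x\<in>N. f x = \<one>\<^bsub>F\<^esub>)}"

definition homs_with_kernel :: "('h, 'm) monoid_scheme \<Rightarrow> 'h set \<Rightarrow> ('f, 'n) monoid_scheme \<Rightarrow> ('h \<Rightarrow> 'f) set" where
  "homs_with_kernel H N F = {f \<in> carrier H \<rightarrow>\<^sub>E carrier F. f \<in> hom H F \<and> kernel H F f = N}"

lemma finite_homs:
  assumes "finite (carrier H)" "finite (carrier F)"
  shows "finite (homs_killing H N F)" "finite (homs_with_kernel H N F)"
  using finite_PiE[of "carrier H" "\<lambda>_. carrier F"] assms
  by (auto simp: homs_killing_def homs_with_kernel_def)

text \<open>Homomorphisms are sorted by their kernel. The sum may run over all larger subsets M,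
  because one that is not a kernel contributes 0.\<close>

lemma card_homs_killing:
  assumes "finite (carrier H)" "finite (carrier F)" "N \<subseteq> carrier H"
  shows "card (homs_killing H N F)
    = card (homs_with_kernel H N F) + (\<Sum>M | N \<subset> M \<and> M \<subseteq> carrier H. card (homs_with_kernel H M F))"
proof -
  let ?S = "{M. N \<subset> M \<and> M \<subseteq> carrier H}"
  have fin: "finite ?S" by (rule finite_subset[of _ "Pow (carrier H)"]) (use assms(1) in auto)
  have "homs_killing H N F = (\<Union>M\<in>insert N ?S. homs_with_kernel H M F)" (is "?L = ?R")
  proof
    show "?L \<subseteq> ?R"
    proof
      fix f assume f: "f \<in> homs_killing H N F"
      then have "N \<subseteq> kernel H F f" "kernel H F f \<subseteq> carrier H"
        using assms(3) by (auto simp: homs_killing_def kernel_def)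
      then have "kernel H F f \<in> insert N ?S" by blast
      moreover have "f \<in> homs_with_kernel H (kernel H F f) F"
        using f by (simp add: homs_killing_def homs_with_kernel_def)
      ultimately show "f \<in> ?R" by blast
    qed
    show "?R \<subseteq> ?L"
    proof
      fix f assume "f \<in> ?R"
      then obtain M where M: "N \<subseteq> M" "f \<in> homs_with_kernel H M F" by blast
      then have "f x = \<one>\<^bsub>F\<^esub>" if "x \<in> N" for x
        using that by (auto simp: homs_with_kernel_def kernel_def)
      then show "f \<in> ?L" using M(2) by (simp add: homs_with_kernel_def homs_killing_def)
    qed
  qed
  then have "card (homs_killing H N F) = (\<Sum>M\<in>insert N ?S. card (homs_with_kernel H M F))"
    using fin finite_homs(2)[OF assms(1,2)]
    by (simp only:, intro card_UN_disjoint) (auto simp: homs_with_kernel_def)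
  then show ?thesis using fin by simp
qed

text \<open>Lovasz's argument: numbers of homomorphisms with prescribed kernel are found by inclusion-exclusion.\<close>

lemma card_homs_with_kernel_eq:
  assumes fin: "finite (carrier H)" "finite (carrier F\<^sub>1)" "finite (carrier F\<^sub>2)"
    and eq: "\<And>N. N \<subseteq> carrier H \<Longrightarrow> card (homs_killing H N F\<^sub>1) = card (homs_killing H N F\<^sub>2)"
    and "N \<subseteq> carrier H"
  shows "card (homs_with_kernel H N F\<^sub>1) = card (homs_with_kernel H N F\<^sub>2)"
  using \<open>N \<subseteq> carrier H\<close>
\<comment> \<open>Descending induction on N: the counts for strictly larger kernels already
  agree.\<close>
proof (induction "card (carrier H) - card N" arbitrary: N rule: less_induct)
  case less
  have "card (homs_with_kernel H M F\<^sub>1) = card (homs_with_kernel H M F\<^sub>2)"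
    if M: "N \<subset> M" "M \<subseteq> carrier H" for M
  proof (rule less.hyps)
    have "card N < card M" "card M \<le> card (carrier H)"
      using M fin(1) by (auto intro: psubset_card_mono card_mono finite_subset)
    then show "card (carrier H) - card M < card (carrier H) - card N" by simp
  qed (rule M(2))
  then have "(\<Sum>M | N \<subset> M \<and> M \<subseteq> carrier H. card (homs_with_kernel H M F\<^sub>1))
      = (\<Sum>M | N \<subset> M \<and> M \<subseteq> carrier H. card (homs_with_kernel H M F\<^sub>2))"
    by (intro sum.cong) auto
  then show ?case
    using eq[OF less.prems] card_homs_killing[OF fin(1,2) less.prems] card_homs_killing[OF fin(1,3) less.prems]
    by simp
qed

text \<open>The identity shows that each group has an injective endomorphism. Equal counts for the
  trivial kernel then embed each group in the other, and finiteness makes an embedding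
  bijective.\<close>

lemma iso_of_card_homs_eq:
  assumes G: "group F\<^sub>1" "group F\<^sub>2" and fin: "finite (carrier F\<^sub>1)" "finite (carrier F\<^sub>2)"
    and eq1: "\<And>N. N \<subseteq> carrier F\<^sub>1 \<Longrightarrow> card (homs_killing F\<^sub>1 N F\<^sub>1) = card (homs_killing F\<^sub>1 N F\<^sub>2)"
    and eq2: "\<And>N. N \<subseteq> carrier F\<^sub>2 \<Longrightarrow> card (homs_killing F\<^sub>2 N F\<^sub>1) = card (homs_killing F\<^sub>2 N F\<^sub>2)"
  shows "F\<^sub>1 \<cong> F\<^sub>2"
proof -
  have one: "{\<one>\<^bsub>F\<^sub>1\<^esub>} \<subseteq> carrier F\<^sub>1" "{\<one>\<^bsub>F\<^sub>2\<^esub>} \<subseteq> carrier F\<^sub>2" using G by (auto simp: group.is_monoid)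
  have id: "restrict (\<lambda>x. x) (carrier K) \<in> homs_with_kernel K {\<one>\<^bsub>K\<^esub>} K" if "group K" for K :: "('x, 'y) monoid_scheme"
    using that by (auto simp: homs_with_kernel_def kernel_def hom_def group.is_monoid monoid.m_closed)
  have "card (homs_with_kernel F\<^sub>1 {\<one>\<^bsub>F\<^sub>1\<^esub>} F\<^sub>1) = card (homs_with_kernel F\<^sub>1 {\<one>\<^bsub>F\<^sub>1\<^esub>} F\<^sub>2)"
    by (rule card_homs_with_kernel_eq[OF fin(1) fin(1) fin(2) eq1 one(1)])
  moreover have "0 < card (homs_with_kernel F\<^sub>1 {\<one>\<^bsub>F\<^sub>1\<^esub>} F\<^sub>1)"
    using id[OF G(1)] finite_homs(2)[OF fin(1) fin(1)] by (auto simp: card_gt_0_iff)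
  ultimately have "homs_with_kernel F\<^sub>1 {\<one>\<^bsub>F\<^sub>1\<^esub>} F\<^sub>2 \<noteq> {}" by auto
  then obtain f where f: "f \<in> hom F\<^sub>1 F\<^sub>2" "kernel F\<^sub>1 F\<^sub>2 f = {\<one>\<^bsub>F\<^sub>1\<^esub>}" by (auto simp: homs_with_kernel_def)
  have "card (homs_with_kernel F\<^sub>2 {\<one>\<^bsub>F\<^sub>2\<^esub>} F\<^sub>1) = card (homs_with_kernel F\<^sub>2 {\<one>\<^bsub>F\<^sub>2\<^esub>} F\<^sub>2)"
    by (rule card_homs_with_kernel_eq[OF fin(2) fin(1) fin(2) eq2 one(2)])
  moreover have "0 < card (homs_with_kernel F\<^sub>2 {\<one>\<^bsub>F\<^sub>2\<^esub>} F\<^sub>2)"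
    using id[OF G(2)] finite_homs(2)[OF fin(2) fin(2)] by (auto simp: card_gt_0_iff)
  ultimately have "homs_with_kernel F\<^sub>2 {\<one>\<^bsub>F\<^sub>2\<^esub>} F\<^sub>1 \<noteq> {}" by auto
  then obtain g where g: "g \<in> hom F\<^sub>2 F\<^sub>1" "kernel F\<^sub>2 F\<^sub>1 g = {\<one>\<^bsub>F\<^sub>2\<^esub>}" by (auto simp: homs_with_kernel_def)
  interpret f: group_hom F\<^sub>1 F\<^sub>2 f using G f(1) by (simp add: group_hom_def group_hom_axioms_def)
  interpret g: group_hom F\<^sub>2 F\<^sub>1 g using G g(1) by (simp add: group_hom_def group_hom_axioms_def)
  have inj: "inj_on f (carrier F\<^sub>1)" "inj_on g (carrier F\<^sub>2)"
    using f.inj_iff_trivial_ker g.inj_iff_trivial_ker f(2) g(2) by auto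
  have sub: "f ` carrier F\<^sub>1 \<subseteq> carrier F\<^sub>2" "g ` carrier F\<^sub>2 \<subseteq> carrier F\<^sub>1" by auto
  have "card (carrier F\<^sub>2) \<le> card (carrier F\<^sub>1)" by (rule card_inj_on_le[OF inj(2) sub(2) fin(1)])
  then have "f ` carrier F\<^sub>1 = carrier F\<^sub>2"
    using card_image[OF inj(1)] by (intro card_seteq[OF fin(2) sub(1)]) simp
  then have "f \<in> iso F\<^sub>1 F\<^sub>2" using f(1) inj(1) by (simp add: iso_def bij_betw_def)
  then show ?thesis by (rule is_isoI)
qed

section \<open>Counting homomorphisms across an isomorphism of shifts\<close>

locale shift_isomorphism = F1: finite_comm_group F\<^sub>1 + F2: finite_comm_group F\<^sub>2
  for F\<^sub>1 :: "('a, 'm) monoid_scheme" and F\<^sub>2 :: "('b, 'n) monoid_scheme" +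
  fixes \<phi>
  assumes \<phi>_iso: "\<phi> \<in> iso (shift_group F\<^sub>1) (shift_group F\<^sub>2)"
    and \<phi>_homeo: "homeomorphic_map (shift_topology F\<^sub>1) (shift_topology F\<^sub>2) \<phi>"
    and \<phi>_equi: "p \<in> carrier (shift_group F\<^sub>1) \<Longrightarrow> right_shift (\<phi> p) = \<phi> (right_shift p)"
begin

sublocale S1: lc_contraction_group "shift_group F\<^sub>1" "shift_topology F\<^sub>1" right_shift
  by (rule F1.shift_contraction_group)

sublocale S2: lc_contraction_group "shift_group F\<^sub>2" "shift_topology F\<^sub>2" right_shift
  by (rule F2.shift_contraction_group)

sublocale \<phi>: group_hom "shift_group F\<^sub>1" "shift_group F\<^sub>2" \<phi>
  using \<phi>_iso by unfold_locales (simp add: iso_def)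

abbreviation "level1 n \<equiv> F1.agree_below n \<one>\<^bsub>shift_group F\<^sub>1\<^esub>"
abbreviation "level2 n \<equiv> F2.agree_below n \<one>\<^bsub>shift_group F\<^sub>2\<^esub>"

lemma \<phi>_equi_iter:
  "p \<in> carrier (shift_group F\<^sub>1) \<Longrightarrow> (right_shift ^^ n) (\<phi> p) = \<phi> ((right_shift ^^ n) p)"
  by (induction n) (auto simp: \<phi>_equi S1.iter_closed)

lemma \<phi>_inj: "inj_on \<phi> (carrier (shift_group F\<^sub>1))" and \<phi>_onto: "\<phi> ` carrier (shift_group F\<^sub>1) = carrier (shift_group F\<^sub>2)"
  using \<phi>_iso by (auto simp: iso_def bij_betw_def)

text \<open>Continuity of \<phi> and of its inverse at the identity gives indices m1 and m2 for a
  single level each; commuting with the shift makes the loss c the same at every n.\<close>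

lemma \<phi>_level_bounds:
  obtains c :: nat where "\<phi> ` level1 0 \<subseteq> level2 (- int c)"
    "\<And>n p. p \<in> carrier (shift_group F\<^sub>1) \<Longrightarrow> \<phi> p \<in> level2 (int n + int c) \<Longrightarrow> p \<in> level1 (int n)"
proof -
  have "openin (shift_topology F\<^sub>1) {p \<in> topspace (shift_topology F\<^sub>1). \<phi> p \<in> level2 0}"
    using homeomorphic_imp_continuous_map[OF \<phi>_homeo] F2.openin_agree_below
    by (rule openin_continuous_map_preimage)
  moreover have "\<one>\<^bsub>shift_group F\<^sub>1\<^esub> \<in> {p \<in> topspace (shift_topology F\<^sub>1). \<phi> p \<in> level2 0}"
    by (simp add: F2.agree_below_mem)
  ultimately obtain m1 where m1: "level1 m1 \<subseteq> {p \<in> topspace (shift_topology F\<^sub>1). \<phi> p \<in> level2 0}"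
    unfolding F1.openin_shift_topology_iff by blast
  have "openin (shift_topology F\<^sub>2) (\<phi> ` level1 0)"
    using homeomorphic_imp_open_map[OF \<phi>_homeo] F1.openin_agree_below unfolding open_map_def by blast
  moreover have "\<one>\<^bsub>shift_group F\<^sub>2\<^esub> \<in> \<phi> ` level1 0"
    using F1.agree_below_mem[OF S1.one_closed] \<phi>.hom_one by (metis image_eqI)
  ultimately obtain m2 where m2: "level2 m2 \<subseteq> \<phi> ` level1 0"
    unfolding F2.openin_shift_topology_iff by blast
  define c where "c = nat (max 0 (max m1 m2))"
  have c: "m1 \<le> int c" "m2 \<le> int c" unfolding c_def by auto
  show thesis
  proof (rule that)
    show "\<phi> ` level1 0 \<subseteq> level2 (- int c)"
    proof
      fix q assume "q \<in> \<phi> ` level1 0"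
      then obtain p where p: "q = \<phi> p" "p \<in> carrier (shift_group F\<^sub>1)" "\<And>k. k < 0 \<Longrightarrow> two_sided p k = \<one>\<^bsub>F\<^sub>1\<^esub>"
        by (auto simp: F1.agree_below_def)
      \<comment> \<open>Shifting right by c, which is at least m1, brings p into the range where
        continuity applies; the shift is undone afterwards and costs c positions.\<close>
      have "(right_shift ^^ c) p \<in> level1 m1"
        using p c(1) by (simp add: F1.agree_below_def S1.iter_closed two_sided_right_shift_iter)
      then have "(right_shift ^^ c) q \<in> level2 0" using m1 \<phi>_equi_iter[OF p(2)] p(1) by auto
      then have "two_sided q (k - int c) = \<one>\<^bsub>F\<^sub>2\<^esub>" if "k < 0" for k
        using that by (simp add: F2.agree_below_def two_sided_right_shift_iter)
      from this[of "_ + int c"] show "q \<in> level2 (- int c)"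
        using p(1,2) by (auto simp: F2.agree_below_def)
    qed
    fix n p assume p: "p \<in> carrier (shift_group F\<^sub>1)" "\<phi> p \<in> level2 (int n + int c)"
    \<comment> \<open>\<open>q\<close> is \<phi> p moved n places to the left. It is trivial below
      c, which is at least m2, so it comes from \<open>level1 0\<close>; moving back shows that p is
      trivial below n.\<close>
    define q where "q = of_two_sided (\<lambda>k. two_sided (\<phi> p) (k + int n))"
    have q1: "two_sided q k = \<one>\<^bsub>F\<^sub>2\<^esub>" if "k < int c" for k
      using p(2) that by (simp add: q_def F2.agree_below_def)
    have qc: "q \<in> carrier (shift_group F\<^sub>2)"
      using q1 F2.two_sided_closed p(1) unfolding q_def by (intro F2.of_two_sided_mem[of _ "int c"]) auto
    then have "q \<in> level2 m2" using q1 c(2) by (simp add: F2.agree_below_def)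
    then obtain p' where p': "q = \<phi> p'" "p' \<in> carrier (shift_group F\<^sub>1)" "\<And>k. k < 0 \<Longrightarrow> two_sided p' k = \<one>\<^bsub>F\<^sub>1\<^esub>"
      using m2 by (auto simp: F1.agree_below_def)
    have "\<phi> ((right_shift ^^ n) p') = (right_shift ^^ n) q" using \<phi>_equi_iter[OF p'(2)] p'(1) by simp
    also have "\<dots> = \<phi> p"
      using qc p(1) by (intro F2.shift_group_eqI) (simp_all add: S2.iter_closed two_sided_right_shift_iter q_def)
    finally have "(right_shift ^^ n) p' = p"
      using inj_onD[OF \<phi>_inj] p(1) p'(2) by (simp add: S1.iter_closed)
    then show "p \<in> level1 (int n)"
      using p' by (auto simp: F1.agree_below_def S1.iter_closed two_sided_right_shift_iter)
  qed
qed

text \<open>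
  A tuple of \<open>n\<close> homomorphisms into \<open>F\<^sub>1\<close>, placed at the positions \<open>0, \<dots>, n - 1\<close>, is
  recovered from the positions \<open>-c, \<dots>, n + c - 1\<close> of its image under \<open>\<phi>\<close>.
\<close>

definition window :: "nat \<Rightarrow> (nat \<Rightarrow> 'h \<Rightarrow> 'a) \<Rightarrow> 'h \<Rightarrow> (int \<Rightarrow> 'a) \<times> (int \<Rightarrow> 'a)" where
  "window n f x = of_two_sided (\<lambda>k. if 0 \<le> k \<and> k < int n then f (nat k) x else \<one>\<^bsub>F\<^sub>1\<^esub>)"

lemma card_homs_power_le:
  assumes H: "group H" "finite (carrier H)" and N: "N \<subseteq> carrier H"
  obtains c :: nat where
    "\<And>n. card (homs_killing H N F\<^sub>1) ^ n \<le> card (homs_killing H N F\<^sub>2) ^ (n + c)"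
proof -
  interpret H: group H by (rule H(1))
  obtain c where c: "\<phi> ` level1 0 \<subseteq> level2 (- int c)"
    "\<And>n p. p \<in> carrier (shift_group F\<^sub>1) \<Longrightarrow> \<phi> p \<in> level2 (int n + int c) \<Longrightarrow> p \<in> level1 (int n)"
    by (rule \<phi>_level_bounds) blast
  have "card (homs_killing H N F\<^sub>1) ^ n \<le> card (homs_killing H N F\<^sub>2) ^ (n + 2 * c)" for n
  proof -
    let ?A = "{..<n} \<rightarrow>\<^sub>E homs_killing H N F\<^sub>1" and ?B = "{..<n + 2 * c} \<rightarrow>\<^sub>E homs_killing H N F\<^sub>2"
    \<comment> \<open>The index j stands for position j - c, so the n + 2c indices cover the window
      widened by c on both sides.\<close>
    define E where "E f = (\<lambda>j\<in>{..<n + 2 * c}. \<lambda>x\<in>carrier H. two_sided (\<phi> (window n f x)) (int j - int c))" for f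
    have hom1: "f i x \<in> carrier F\<^sub>1" if "f \<in> ?A" "i < n" "x \<in> carrier H" for f i x
      using that by (auto simp: homs_killing_def)
    have mem: "window n f x \<in> carrier (shift_group F\<^sub>1)" if "f \<in> ?A" "x \<in> carrier H" for f x
      unfolding window_def using hom1[OF that(1) _ that(2)] by (intro F1.of_two_sided_mem[of _ 0]) auto
    have mult: "window n f (x \<otimes>\<^bsub>H\<^esub> y) = window n f x \<otimes>\<^bsub>shift_group F\<^sub>1\<^esub> window n f y"
      if f: "f \<in> ?A" and xy: "x \<in> carrier H" "y \<in> carrier H" for f x y
    proof (rule F1.shift_group_eqI)
      have "f i (x \<otimes>\<^bsub>H\<^esub> y) = f i x \<otimes>\<^bsub>F\<^sub>1\<^esub> f i y" if "i < n" for i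
        using f xy that by (auto simp: homs_killing_def hom_def PiE_iff)
      then show "two_sided (window n f (x \<otimes>\<^bsub>H\<^esub> y)) k = two_sided (window n f x \<otimes>\<^bsub>shift_group F\<^sub>1\<^esub> window n f y) k" for k
        by (simp add: window_def nat_less_iff)
    qed (use mem[OF f] xy in auto)
    have one: "window n f x = \<one>\<^bsub>shift_group F\<^sub>1\<^esub>" if f: "f \<in> ?A" and x: "x \<in> N" for f x
    proof (rule F1.shift_group_eqI)
      have "f i x = \<one>\<^bsub>F\<^sub>1\<^esub>" if "i < n" for i
        using f x that by (auto simp: homs_killing_def PiE_iff)
      then show "two_sided (window n f x) k = two_sided \<one>\<^bsub>shift_group F\<^sub>1\<^esub> k" for k
        by (simp add: window_def nat_less_iff)
    qed (use mem[OF f] x N in auto)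
    have "E f \<in> ?B" if f: "f \<in> ?A" for f
    proof -
      \<comment> \<open>Composing the window, \<phi> and the reading of one coordinate gives a
        homomorphism that still kills N.\<close>
      have "(\<lambda>x\<in>carrier H. two_sided (\<phi> (window n f x)) k) \<in> homs_killing H N F\<^sub>2" for k
        using mem[OF f] mult[OF f] one[OF f] N F2.two_sided_closed[OF \<phi>.hom_closed[OF mem[OF f]]]
        by (auto simp: homs_killing_def hom_def)
      then show ?thesis by (simp add: E_def)
    qed
    moreover have "inj_on E ?A"
    proof (rule inj_onI)
      fix f g assume fg: "f \<in> ?A" "g \<in> ?A" "E f = E g"
      have "f i x = g i x" if i: "i < n" and x: "x \<in> carrier H" for i x
      proof -
        let ?p = "window n f x" and ?q = "window n g x"
        have pq: "?p \<in> carrier (shift_group F\<^sub>1)" "?q \<in> carrier (shift_group F\<^sub>1)" using mem fg x by auto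
        have "?p \<in> level1 0" "?q \<in> level1 0" using pq by (auto simp: F1.agree_below_def window_def)
        then have lev: "\<phi> ?p \<in> level2 (- int c)" "\<phi> ?q \<in> level2 (- int c)" using c(1) by auto
        have "two_sided (\<phi> ?p) k = two_sided (\<phi> ?q) k" if "k < int n + int c" for k
        proof (cases "k < - int c")
          case True
          then show ?thesis using lev by (simp add: F2.agree_below_def)
        next
          case False
          define j where "j = nat (k + int c)"
          have j: "j < n + 2 * c" "int j - int c = k" using False that unfolding j_def by auto
          have "E f j x = E g j x" using fg(3) by simp
          then show ?thesis using j x by (simp add: E_def)
        qed
        \<comment> \<open>The images agree below n + c: trivially to the left of -c, and by
          \<open>E f = E g\<close> from there on. So their quotient is trivial below n + c, and the
          second level bound makes the windows agree below n.\<close>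
        then have "\<phi> (?p \<otimes>\<^bsub>shift_group F\<^sub>1\<^esub> inv\<^bsub>shift_group F\<^sub>1\<^esub> ?q) \<in> level2 (int n + int c)"
          using pq by (simp add: F2.agree_below_def F2.two_sided_inv F2.two_sided_closed)
        then have "?p \<otimes>\<^bsub>shift_group F\<^sub>1\<^esub> inv\<^bsub>shift_group F\<^sub>1\<^esub> ?q \<in> level1 (int n)"
          using pq by (intro c(2)) auto
        then have "two_sided ?p (int i) \<otimes>\<^bsub>F\<^sub>1\<^esub> inv\<^bsub>F\<^sub>1\<^esub> two_sided ?q (int i) = \<one>\<^bsub>F\<^sub>1\<^esub>"
          using i pq by (simp add: F1.agree_below_def F1.two_sided_inv)
        then have "two_sided ?p (int i) = two_sided ?q (int i)"
          using F1.two_sided_closed pq by (metis F1.inv_closed F1.inv_equality F1.inv_inv)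
        then show ?thesis using i by (simp add: window_def)
      qed
      then have "f i = g i" if "i < n" for i
        using fg(1,2) that by (intro PiE_ext[of "f i" "carrier H"]) (auto simp: homs_killing_def PiE_iff)
      then show "f = g" using fg(1,2) by (intro PiE_ext[of f "{..<n}"]) auto
    qed
    moreover have "finite ?B" using finite_homs(1)[OF H(2) F2.finite_carrier] by (intro finite_PiE) auto
    ultimately have "card ?A \<le> card ?B" by (intro card_inj_on_le[of E]) auto
    then show ?thesis by (simp add: card_PiE)
  qed
  then show thesis by (rule that)
qed

lemma card_homs_killing_le:
  assumes H: "group H" "finite (carrier H)" and N: "N \<subseteq> carrier H"
  shows "card (homs_killing H N F\<^sub>1) \<le> card (homs_killing H N F\<^sub>2)"
proof -
  interpret H: group H by (rule H(1))
  obtain c where c: "\<And>n. card (homs_killing H N F\<^sub>1) ^ n \<le> card (homs_killing H N F\<^sub>2) ^ (n + c)"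
    by (rule card_homs_power_le[OF assms]) blast
  have "(\<lambda>x\<in>carrier H. \<one>\<^bsub>F\<^sub>2\<^esub>) \<in> homs_killing H N F\<^sub>2"
    using N by (auto simp: homs_killing_def hom_def)
  then have "0 < card (homs_killing H N F\<^sub>2)"
    using finite_homs(1)[OF H(2) F2.finite_carrier] by (auto simp: card_gt_0_iff)
  then show ?thesis using le_of_power_le[OF c] by blast
qed

end

lemma card_homs_killing_le_of_isomorphic_shifts:
  assumes F1: "comm_group F\<^sub>1" "finite (carrier F\<^sub>1)" and F2: "comm_group F\<^sub>2" "finite (carrier F\<^sub>2)"
    and iso: "isomorphic_contraction_groups (shift_group F\<^sub>1) (shift_topology F\<^sub>1) right_shift
      (shift_group F\<^sub>2) (shift_topology F\<^sub>2) right_shift"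
    and H: "group H" "finite (carrier H)" "N \<subseteq> carrier H"
  shows "card (homs_killing H N F\<^sub>1) \<le> card (homs_killing H N F\<^sub>2)"
proof -
  obtain \<phi> where \<phi>: "\<phi> \<in> iso (shift_group F\<^sub>1) (shift_group F\<^sub>2)"
    "homeomorphic_map (shift_topology F\<^sub>1) (shift_topology F\<^sub>2) \<phi>"
    "\<And>p. p \<in> carrier (shift_group F\<^sub>1) \<Longrightarrow> right_shift (\<phi> p) = \<phi> (right_shift p)"
    using iso unfolding isomorphic_contraction_groups_def by blast
  interpret shift_isomorphism F\<^sub>1 F\<^sub>2 \<phi>
    using F1 F2 \<phi> by (intro shift_isomorphism.intro shift_isomorphism_axioms.intro
      finite_comm_group.intro finite_comm_group_axioms.intro)
  show ?thesis by (rule card_homs_killing_le[OF H])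
qed

theorem shift_group_determines_finite_group:
  assumes F1: "comm_group F\<^sub>1" "finite (carrier F\<^sub>1)" and F2: "comm_group F\<^sub>2" "finite (carrier F\<^sub>2)"
    and iso: "isomorphic_contraction_groups (shift_group F\<^sub>1) (shift_topology F\<^sub>1) right_shift
      (shift_group F\<^sub>2) (shift_topology F\<^sub>2) right_shift"
  shows "F\<^sub>1 \<cong> F\<^sub>2"
proof -
  interpret F1: finite_comm_group F\<^sub>1 using F1 by (intro finite_comm_group.intro finite_comm_group_axioms.intro)
  have iso': "isomorphic_contraction_groups (shift_group F\<^sub>2) (shift_topology F\<^sub>2) right_shift
      (shift_group F\<^sub>1) (shift_topology F\<^sub>1) right_shift"
    by (rule isomorphic_contraction_groups_sym[OF F1.group_shift_group F1.topspace_shift_topology F1.right_shift_mem iso])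
  note le = card_homs_killing_le_of_isomorphic_shifts[OF F1 F2 iso]
    and ge = card_homs_killing_le_of_isomorphic_shifts[OF F2 F1 iso']
  have G: "group F\<^sub>1" "group F\<^sub>2" using F1(1) F2(1) by (auto simp: comm_group_def)
  show ?thesis
    by (rule iso_of_card_homs_eq[OF G F1(2) F2(2)])
      (intro antisym le ge G F1(2) F2(2); assumption)+
qed

section \<open>Classification of abelian torsion contraction groups\<close>

theorem theoremD:
  fixes G :: "('a, 'm) monoid_scheme" and T :: "'a topology" and \<alpha> :: "'a \<Rightarrow> 'a"
  shows
    "(lc_contraction_group G T \<alpha> \<and> totally_disconnected_space T \<and> torsion_group G \<and> comm_group G \<longrightarrow>
        (\<exists>F :: nat monoid. comm_group F \<and> finite (carrier F) \<and>
           isomorphic_contraction_groups G T \<alpha> (shift_group F) (shift_topology F) right_shift) \<and>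
        (\<forall>(F\<^sub>1 :: ('b, 'n) monoid_scheme) (F\<^sub>2 :: ('c, 'k) monoid_scheme).
           comm_group F\<^sub>1 \<and> finite (carrier F\<^sub>1) \<and>
           isomorphic_contraction_groups G T \<alpha> (shift_group F\<^sub>1) (shift_topology F\<^sub>1) right_shift \<and>
           comm_group F\<^sub>2 \<and> finite (carrier F\<^sub>2) \<and>
           isomorphic_contraction_groups G T \<alpha> (shift_group F\<^sub>2) (shift_topology F\<^sub>2) right_shift
           \<longrightarrow> F\<^sub>1 \<cong> F\<^sub>2)) \<and>
     (\<forall>F :: ('d, 'l) monoid_scheme. comm_group F \<and> finite (carrier F) \<longrightarrow>
        lc_contraction_group (shift_group F) (shift_topology F) right_shift \<and>
        totally_disconnected_space (shift_topology F) \<and>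
        torsion_group (shift_group F) \<and> comm_group (shift_group F))"
proof (intro conjI impI allI)
  assume G: "lc_contraction_group G T \<alpha> \<and> totally_disconnected_space T \<and> torsion_group G \<and> comm_group G"
  then interpret G: lc_contraction_group G T \<alpha> by blast
  show "\<exists>F :: nat monoid. comm_group F \<and> finite (carrier F) \<and>
      isomorphic_contraction_groups G T \<alpha> (shift_group F) (shift_topology F) right_shift"
    using G by (intro G.shift_isomorphism_exists) auto
  fix F\<^sub>1 :: "('b, 'n) monoid_scheme" and F\<^sub>2 :: "('c, 'k) monoid_scheme"
  assume F: "comm_group F\<^sub>1 \<and> finite (carrier F\<^sub>1) \<and>
      isomorphic_contraction_groups G T \<alpha> (shift_group F\<^sub>1) (shift_topology F\<^sub>1) right_shift \<and>
      comm_group F\<^sub>2 \<and> finite (carrier F\<^sub>2) \<and>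
      isomorphic_contraction_groups G T \<alpha> (shift_group F\<^sub>2) (shift_topology F\<^sub>2) right_shift"
  have "isomorphic_contraction_groups (shift_group F\<^sub>1) (shift_topology F\<^sub>1) right_shift G T \<alpha>"
    using F G.iter_closed[of _ 1]
    by (intro isomorphic_contraction_groups_sym[OF G.is_group G.topspace_eq]) auto
  then have "isomorphic_contraction_groups (shift_group F\<^sub>1) (shift_topology F\<^sub>1) right_shift
      (shift_group F\<^sub>2) (shift_topology F\<^sub>2) right_shift"
    by (rule isomorphic_contraction_groups_trans) (use F in blast)
  then show "F\<^sub>1 \<cong> F\<^sub>2" using F by (intro shift_group_determines_finite_group) auto
next
  fix F :: "('d, 'l) monoid_scheme"
  assume "comm_group F \<and> finite (carrier F)"
  then interpret finite_comm_group F
    by (intro finite_comm_group.intro finite_comm_group_axioms.intro) auto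
  show "lc_contraction_group (shift_group F) (shift_topology F) right_shift"
    by (rule shift_contraction_group)
  show "totally_disconnected_space (shift_topology F)" by (rule totally_disconnected_shift_topology)
  show "torsion_group (shift_group F)" by (rule torsion_shift_group)
  show "comm_group (shift_group F)" by (rule comm_group_shift_group)
qed

end
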